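(* Let $G$ be a branch group. Then $G$ does not admit a $2$-set-transitive action on any infinite set, nor a $2$-transitive action on any infinite set. In particular, the transitivity degree of $G$ is $1$.
   Context: An action of a group $G$ on a set $X$ is $n$-transitive if any $n$-tuple of distinct points of $X$ can be sent to any other such $n$-tuple by an element of $G$; it is $n$-set-transitive if $G$ acts transitively on the set of subsets of $X$ of size $n$. The transitivity degree of a group $G$ is the supremum of all $n\in\mathbb{N}$ such that $G$ admits a faithful $n$-transitive action. Here $\mathbb{N}=\{0,1,2,\dots\}$. Let $(A_i)_{i\in\mathbb{N}}$ be a sequence of finite sets with $|A_i|\ge 2$. The associated (spherically homogeneous) rooted tree $T$ has as vertices all finite words $v=(a_0,\dots,a_{k-1})\in A_0\times\cdots\times A_{k-1}$, $k\ge 0$, with root the empty word; $|v|=k$ is the length of $v$; $v\le w$ means that $v$ is a prefix of $w$; $v$ and $w$ are adjacent if $v\le w$ and $|w|=|v|+1$ (or vice versa). The $n$th level $\mathcal{L}_n$ is the set of vertices of length $n$, and $T_v$ is the subtree of all $w\ge v$. $\operatorname{Aut}(T)$ is the group of graph automorphisms of $T$ fixing the root. For $G\le\operatorname{Aut}(T)$ and $v\in T$, $\operatorname{Rist}_G(v)=\{g\in G: gw=w \text{ for all } w\notin T_v\}$, and $\operatorname{Rist}_G(n)$ is the subgroup generated by all $\operatorname{Rist}_G(v)$, $v\in\mathcal{L}_n$. $G\le\operatorname{Aut}(T)$ is a branch group if $G$ acts transitively on $\mathcal{L}_n$ for every $n\in\mathbb{N}$ and $\operatorname{Rist}_G(n)$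 has finite index in $G$ for every $n\in\mathbb{N}$. *)

theory Defs
  imports "HOL-Algebra.Group_Action" "HOL-Algebra.Generated_Groups" "HOL-Library.Sublist" "HOL-Library.Extended_Nat"
begin

definition tree_verts :: "(nat \<Rightarrow> 'a set) \<Rightarrow> 'a list set" where
  "tree_verts A = {v. \<forall>i<length v. v ! i \<in> A i}"

definition tree_level :: "(nat \<Rightarrow> 'a set) \<Rightarrow> nat \<Rightarrow> 'a list set" where
  "tree_level A n = {v \<in> tree_verts A. length v = n}"

definition tree_adj :: "'a list \<Rightarrow> 'a list \<Rightarrow> bool" where
  "tree_adj v w \<longleftrightarrow> (prefix v w \<and> length w = Suc (length v)) \<or>
                    (prefix w v \<and> length v = Suc (length w))"

definition subtree :: "(nat \<Rightarrow> 'a set) \<Rightarrow> 'a list \<Rightarrow> 'a list set" where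
  "subtree A v = {w \<in> tree_verts A. prefix v w}"

definition tree_auts :: "(nat \<Rightarrow> 'a set) \<Rightarrow> ('a list \<Rightarrow> 'a list) set" where
  "tree_auts A = {f \<in> Bij (tree_verts A). f [] = [] \<and>
     (\<forall>v\<in>tree_verts A. \<forall>w\<in>tree_verts A. tree_adj (f v) (f w) \<longleftrightarrow> tree_adj v w)}"

definition Aut_tree :: "(nat \<Rightarrow> 'a set) \<Rightarrow> ('a list \<Rightarrow> 'a list) monoid" where
  "Aut_tree A = (BijGroup (tree_verts A))\<lparr>carrier := tree_auts A\<rparr>"

lemma subgroup_tree_auts: "subgroup (tree_auts A) (BijGroup (tree_verts A))"
proof (rule group.subgroupI[OF group_BijGroup])
  let ?V = "tree_verts A"
  have root: "[] \<in> ?V" by (simp add: tree_verts_def)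
  show "tree_auts A \<subseteq> carrier (BijGroup ?V)"
    by (auto simp: tree_auts_def BijGroup_def)
  have "(\<lambda>x\<in>?V. x) \<in> tree_auts A"
    using root by (auto simp: tree_auts_def id_Bij)
  then show "tree_auts A \<noteq> {}" by blast
next
  let ?V = "tree_verts A"
  have root: "[] \<in> ?V" by (simp add: tree_verts_def)
  fix f assume f: "f \<in> tree_auts A"
  then have fB: "f \<in> Bij ?V" and f0: "f [] = []"
    and adj: "\<And>v w. v \<in> ?V \<Longrightarrow> w \<in> ?V \<Longrightarrow> tree_adj (f v) (f w) \<longleftrightarrow> tree_adj v w"
    by (auto simp: tree_auts_def)
  have bij: "bij_betw f ?V ?V" using fB by (simp add: Bij_def)
  have mem: "inv_into ?V f x \<in> ?V" and finv: "f (inv_into ?V f x) = x" if "x \<in> ?V" for x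
    using bij that by (auto simp: bij_betw_def inv_into_into f_inv_into_f)
  have inv0: "inv_into ?V f [] = []"
    using bij root f0 by (metis bij_betw_def inv_into_f_f)
  have "restrict (inv_into ?V f) ?V \<in> tree_auts A"
    unfolding tree_auts_def
    using restrict_inv_into_Bij[OF fB] root inv0 adj[OF mem mem, symmetric] by (simp add: finv)
  then show "inv\<^bsub>BijGroup ?V\<^esub> f \<in> tree_auts A"
    using inv_BijGroup[OF fB] by simp
  fix g assume g: "g \<in> tree_auts A"
  then have gB: "g \<in> Bij ?V" and g0: "g [] = []"
    and adjg: "\<And>v w. v \<in> ?V \<Longrightarrow> w \<in> ?V \<Longrightarrow> tree_adj (g v) (g w) \<longleftrightarrow> tree_adj v w"
    by (auto simp: tree_auts_def)
  have gm: "g x \<in> ?V" if "x \<in> ?V" for x using Bij_imp_funcset[OF gB] that by auto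
  have "compose ?V f g \<in> tree_auts A"
    unfolding tree_auts_def using compose_Bij[OF fB gB] root f0 g0 adj adjg gm
    by (auto simp: compose_def)
  then show "f \<otimes>\<^bsub>BijGroup ?V\<^esub> g \<in> tree_auts A"
    using fB gB by (simp add: BijGroup_def)
qed

lemma group_Aut_tree: "group (Aut_tree A)"
  unfolding Aut_tree_def
  by (rule group.subgroup_imp_group[OF group_BijGroup subgroup_tree_auts])

definition Rist :: "(nat \<Rightarrow> 'a set) \<Rightarrow> ('a list \<Rightarrow> 'a list) set \<Rightarrow> 'a list \<Rightarrow> ('a list \<Rightarrow> 'a list) set"
  where "Rist A G v = {g \<in> G. \<forall>w \<in> tree_verts A - subtree A v. g w = w}"

definition Rist_level ::
    "(nat \<Rightarrow> 'a set) \<Rightarrow> ('a list \<Rightarrow> 'a list) set \<Rightarrow> nat \<Rightarrow> ('a list \<Rightarrow> 'a list) set"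
  where "Rist_level A G n = generate (Aut_tree A) (\<Union>v \<in> tree_level A n. Rist A G v)"

abbreviation tree_group ::
    "(nat \<Rightarrow> 'a set) \<Rightarrow> ('a list \<Rightarrow> 'a list) set \<Rightarrow> ('a list \<Rightarrow> 'a list) monoid"
  where "tree_group A G \<equiv> (Aut_tree A)\<lparr>carrier := G\<rparr>"

definition branch_group :: "(nat \<Rightarrow> 'a set) \<Rightarrow> ('a list \<Rightarrow> 'a list) set \<Rightarrow> bool" where
  "branch_group A G \<longleftrightarrow>
     subgroup G (Aut_tree A) \<and>
     (\<forall>n. \<forall>v \<in> tree_level A n. \<forall>w \<in> tree_level A n. \<exists>g \<in> G. g v = w) \<and>
     (\<forall>n. finite (rcosets\<^bsub>tree_group A G\<^esub> (Rist_level A G n)))"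

definition n_transitive ::
    "('g, 'm) monoid_scheme \<Rightarrow> 'x set \<Rightarrow> ('g \<Rightarrow> 'x \<Rightarrow> 'x) \<Rightarrow> nat \<Rightarrow> bool" where
  "n_transitive G \<Omega> \<phi> n \<longleftrightarrow>
     (\<forall>xs ys. set xs \<subseteq> \<Omega> \<and> distinct xs \<and> length xs = n \<and>
              set ys \<subseteq> \<Omega> \<and> distinct ys \<and> length ys = n \<longrightarrow>
              (\<exists>g \<in> carrier G. map (\<phi> g) xs = ys))"

definition n_set_transitive ::
    "('g, 'm) monoid_scheme \<Rightarrow> 'x set \<Rightarrow> ('g \<Rightarrow> 'x \<Rightarrow> 'x) \<Rightarrow> nat \<Rightarrow> bool" where
  "n_set_transitive G \<Omega> \<phi> n \<longleftrightarrow>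
     (\<forall>B C. B \<subseteq> \<Omega> \<and> finite B \<and> card B = n \<and>
            C \<subseteq> \<Omega> \<and> finite C \<and> card C = n \<longrightarrow>
            (\<exists>g \<in> carrier G. \<phi> g ` B = C))"

text \<open>The supremum ranges over actions on arbitrary sets, but HOL cannot quantify over types
  inside a definition. Subsets of the type of group elements suffice: by
  \<open>transitivity_degree_universe\<close> below, a faithful \<open>n\<close>-transitive action on a set of any
  type gives one on such a subset.\<close>

definition transitivity_degree :: "('g, 'm) monoid_scheme \<Rightarrow> enat" where
  "transitivity_degree G =
     Sup {enat n | n. \<exists>(\<Omega> :: 'g set) \<phi>. faithful_action G \<Omega> \<phi> \<and> n_transitive G \<Omega> \<phi> n}"

lemma faithful_n_transitive_transport:
  fixes G :: "('g, 'm) monoid_scheme" and \<Omega> :: "'x set" and Y :: "'y set"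
  assumes act: "faithful_action G \<Omega> \<phi>" and nt: "n_transitive G \<Omega> \<phi> n" and h: "bij_betw h \<Omega> Y"
  shows "\<exists>\<psi>. faithful_action G Y \<psi> \<and> n_transitive G Y \<psi> n"
proof -
  interpret faithful_action G \<Omega> \<phi> by (rule act)
  interpret group G using group_hom group_hom.axioms(1) by blast
  define k where "k = inv_into \<Omega> h"
  have k: "bij_betw k Y \<Omega>" unfolding k_def by (rule bij_betw_inv_into[OF h])
  have kh: "k (h x) = x" if "x \<in> \<Omega>" for x
    unfolding k_def using h that by (simp add: bij_betw_inv_into_left)
  have hk: "h (k y) = y" if "y \<in> Y" for y
    unfolding k_def using h that by (simp add: bij_betw_inv_into_right)
  have hW: "h x \<in> Y" if "x \<in> \<Omega>" for x using h that by (auto simp: bij_betw_def)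
  have kY: "k y \<in> \<Omega>" if "y \<in> Y" for y using k that by (auto simp: bij_betw_def)
  have pW: "\<phi> g x \<in> \<Omega>" if "g \<in> carrier G" "x \<in> \<Omega>" for g x
    using element_image that by blast
  define \<psi> where "\<psi> = (\<lambda>g. \<lambda>y\<in>Y. h (\<phi> g (k y)))"
  have B: "\<psi> g \<in> Bij Y" if g: "g \<in> carrier G" for g
  proof -
    have "bij_betw (\<phi> g) \<Omega> \<Omega>" using bij_prop0[OF g] by (simp add: Bij_def)
    then have "bij_betw (h \<circ> (\<phi> g \<circ> k)) Y Y"
      using h k by (blast intro: bij_betw_trans)
    then have "bij_betw (\<psi> g) Y Y"
      by (rule bij_betw_cong[THEN iffD1, rotated]) (simp add: \<psi>_def)
    then show ?thesis by (simp add: Bij_def \<psi>_def)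
  qed
  have M: "\<psi> (a \<otimes>\<^bsub>G\<^esub> b) = \<psi> a \<otimes>\<^bsub>BijGroup Y\<^esub> \<psi> b" if "a \<in> carrier G" "b \<in> carrier G" for a b
  proof -
    have "\<psi> (a \<otimes>\<^bsub>G\<^esub> b) = compose Y (\<psi> a) (\<psi> b)"
      by (rule ext) (simp add: \<psi>_def compose_def composition_rule that kY kh hW pW)
    then show ?thesis using B that by (simp add: BijGroup_def)
  qed
  have "\<psi> \<in> hom G (BijGroup Y)"
    by (rule homI) (use B M in \<open>auto simp: BijGroup_def\<close>)
  then have ga: "group_action G Y \<psi>"
    by (simp add: group_action_def group_hom_def group_hom_axioms_def group_BijGroup is_group)
  have "a = b" if ab: "a \<in> carrier G" "b \<in> carrier G" "\<psi> a = \<psi> b" for a b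
  proof -
    have "\<phi> a x = \<phi> b x" if x: "x \<in> \<Omega>" for x
    proof -
      have "\<psi> a (h x) = \<psi> b (h x)" by (simp add: ab(3))
      then have "h (\<phi> a x) = h (\<phi> b x)" using x by (simp add: \<psi>_def hW kh)
      then show ?thesis using kh pW x ab by metis
    qed
    moreover have "\<phi> a \<in> extensional \<Omega>" "\<phi> b \<in> extensional \<Omega>"
      using bij_prop0 ab by (auto simp: Bij_def)
    ultimately have "\<phi> a = \<phi> b" by (metis extensionalityI)
    then show ?thesis using faithful ab by (simp add: inj_on_def)
  qed
  then have "faithful_action G Y \<psi>"
    using ga by (simp add: faithful_action_def faithful_action_axioms_def inj_on_def)
  moreover have "n_transitive G Y \<psi> n"
    unfolding n_transitive_def
  proof (intro allI impI)
    fix xs ys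
    assume a: "set xs \<subseteq> Y \<and> distinct xs \<and> length xs = n \<and>
               set ys \<subseteq> Y \<and> distinct ys \<and> length ys = n"
    have inj: "inj_on k (set xs)" "inj_on k (set ys)"
      using k a by (auto simp: bij_betw_def intro: inj_on_subset)
    have "\<exists>g \<in> carrier G. map (\<phi> g) (map k xs) = map k ys"
      by (rule nt[unfolded n_transitive_def, rule_format])
        (use a inj kY in \<open>auto simp: distinct_map\<close>)
    then obtain g where g: "g \<in> carrier G" "map (\<phi> g) (map k xs) = map k ys" by blast
    have "map (\<psi> g) xs = map h (map (\<phi> g) (map k xs))"
      using a by (auto simp: \<psi>_def)
    also have "\<dots> = map (\<lambda>y. h (k y)) ys" by (simp add: g(2) del: map_map) (simp add: comp_def)
    also have "\<dots> = ys" using a hk by (auto intro: map_idI)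
    finally show "\<exists>g \<in> carrier G. map (\<psi> g) xs = ys" using g(1) by blast
  qed
  ultimately show ?thesis by blast
qed

lemma (in group) faithful_action_regular:
  "faithful_action G (carrier G) (\<lambda>g. \<lambda>x\<in>carrier G. g \<otimes> x)"
proof -
  let ?\<phi> = "\<lambda>g. \<lambda>x\<in>carrier G. g \<otimes> x"
  have B: "?\<phi> g \<in> Bij (carrier G)" if g: "g \<in> carrier G" for g
    unfolding Bij_def
    by (simp, rule bij_betw_byWitness[where f' = "\<lambda>x. inv g \<otimes> x"])
      (use g in \<open>auto simp: m_assoc[symmetric]\<close>)
  have "?\<phi> \<in> hom G (BijGroup (carrier G))"
  proof (rule homI)
    fix a b assume ab: "a \<in> carrier G" "b \<in> carrier G"
    have "?\<phi> (a \<otimes> b) = compose (carrier G) (?\<phi> a) (?\<phi> b)"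
      by (rule ext) (use ab in \<open>simp add: compose_def m_assoc\<close>)
    then show "?\<phi> (a \<otimes> b) = ?\<phi> a \<otimes>\<^bsub>BijGroup (carrier G)\<^esub> ?\<phi> b"
      using B ab by (simp add: BijGroup_def)
  qed (use B in \<open>simp add: BijGroup_def\<close>)
  moreover have "a = b" if ab: "a \<in> carrier G" "b \<in> carrier G" "?\<phi> a = ?\<phi> b" for a b
    using fun_cong[OF ab(3), of \<one>] ab(1,2) by simp
  ultimately show ?thesis
    by (simp add: faithful_action_def faithful_action_axioms_def group_action_def group_hom_def
        group_hom_axioms_def group_BijGroup is_group inj_on_def)
qed

lemma n_transitive_vacuous:
  assumes "finite \<Omega>" "card \<Omega> < n" shows "n_transitive G \<Omega> \<phi> n"
  using assms unfolding n_transitive_def by (metis card_mono distinct_card leD)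

lemma transitivity_degree_universe:
  fixes G :: "('g, 'm) monoid_scheme" and \<Omega> :: "'x set"
  assumes act: "faithful_action G \<Omega> \<phi>" and nt: "n_transitive G \<Omega> \<phi> n"
  shows "\<exists>(Y :: 'g set) \<psi>. faithful_action G Y \<psi> \<and> n_transitive G Y \<psi> n"
proof -
  interpret faithful_action G \<Omega> \<phi> by (rule act)
  interpret group G using group_hom group_hom.axioms(1) by blast
  have emb: ?thesis if "inj_on f \<Omega>" for f :: "'x \<Rightarrow> 'g"
    using faithful_n_transitive_transport[OF act nt, of f "f ` \<Omega>"] that
    by (auto simp: bij_betw_def)
  consider "n = 0" | "n > 0" "finite \<Omega>" "card \<Omega> < n" | "n > 0" "finite \<Omega> \<longrightarrow> n \<le> card \<Omega>"
    by linarith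
  then show ?thesis
  proof cases
    case 1
    then have "n_transitive G (carrier G) (\<lambda>g. \<lambda>x\<in>carrier G. g \<otimes>\<^bsub>G\<^esub> x) n"
      by (auto simp: n_transitive_def)
    then show ?thesis using faithful_action_regular by blast
  next
    case 2
    show ?thesis
    proof (cases "finite (carrier G) \<and> card (carrier G) < n")
      case True
      then show ?thesis using faithful_action_regular n_transitive_vacuous by blast
    next
      case False
      then have "\<exists>f. f ` \<Omega> \<subseteq> carrier G \<and> inj_on f \<Omega>"
      proof (cases "finite (carrier G)")
        case True
        then show ?thesis using False 2 by (intro card_le_inj) auto
      next
        case inf: False
        obtain Y where Y: "Y \<subseteq> carrier G" "finite Y" "card Y = card \<Omega>"
          using infinite_arbitrarily_large[OF inf] by blast
        then obtain f where "f ` \<Omega> \<subseteq> Y" "inj_on f \<Omega>"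
          using 2 card_le_inj[of \<Omega> Y] by auto
        then show ?thesis using Y(1) by blast
      qed
      then show ?thesis using emb by blast
    qed
  next
    case 3
    have tr: "\<exists>g \<in> carrier G. \<phi> g x = y" if xy: "x \<in> \<Omega>" "y \<in> \<Omega>" for x y
    proof -
      have "\<exists>xs. set xs \<subseteq> \<Omega> \<and> distinct xs \<and> length xs = n \<and> hd xs = x" if x: "x \<in> \<Omega>" for x
      proof -
        have "\<exists>Z \<subseteq> \<Omega> - {x}. finite Z \<and> card Z = n - 1"
        proof (cases "finite \<Omega>")
          case True
          then have "n - 1 \<le> card (\<Omega> - {x})" using 3 x by simp
          then show ?thesis using True by (meson finite_Diff obtain_subset_with_card_n)
        next
          case False
          then show ?thesis using infinite_arbitrarily_large[of "\<Omega> - {x}"] by auto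
        qed
        then obtain Z where Z: "Z \<subseteq> \<Omega> - {x}" "finite Z" "card Z = n - 1" by blast
        obtain zs where zs: "set zs = Z" "distinct zs" using finite_distinct_list[OF Z(2)] by blast
        have "length zs = n - 1" using zs Z distinct_card by metis
        then have "set (x # zs) \<subseteq> \<Omega> \<and> distinct (x # zs) \<and> length (x # zs) = n \<and> hd (x # zs) = x"
          using zs Z x 3(1) by auto
        then show ?thesis by blast
      qed
      then obtain xs ys where
        "set xs \<subseteq> \<Omega>" "distinct xs" "length xs = n" "hd xs = x"
        "set ys \<subseteq> \<Omega>" "distinct ys" "length ys = n" "hd ys = y" using xy by meson
      moreover from this obtain g where "g \<in> carrier G" "map (\<phi> g) xs = ys"
        using nt unfolding n_transitive_def by blast
      ultimately show ?thesis using 3(1) by (metis hd_map length_greater_0_conv)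
    qed
    show ?thesis
    proof (cases "\<Omega> = {}")
      case True
      then show ?thesis using emb by (metis inj_on_empty)
    next
      case False
      then obtain x where x: "x \<in> \<Omega>" by blast
      define f where "f y = (SOME g. g \<in> carrier G \<and> \<phi> g x = y)" for y
      have "\<phi> (f y) x = y" if "y \<in> \<Omega>" for y
        using someI_ex[of "\<lambda>g. g \<in> carrier G \<and> \<phi> g x = y"] tr[OF x that] unfolding f_def by blast
      then have "inj_on f \<Omega>" by (metis inj_onI)
      then show ?thesis by (rule emb)
    qed
  qed
qed

end

theory Submission
  imports Defs
begin

text \<open>
  Let \<open>G\<close> act \<open>2\<close>-set-transitively on an infinite set. The rigid stabilizers \<open>Rist(v)\<close> of the vertices
  of level \<open>2\<close> commute pairwise, are permuted transitively by conjugation, and generate a subgroup \<open>N\<close>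
  of finite index. One of them moves some point \<open>x\<close> to \<open>y \<noteq> x\<close>; moving \<open>{x, y}\<close> around shows that any
  two points lie in a common orbit of some \<open>Rist(v)\<close>. So finitely many orbits \<open>Rist(v) x\<close> cover the
  set, and B. H. Neumann's covering argument together with conjugation shows that every \<open>Rist(v)\<close> has
  only finitely many orbits. If \<open>A\<close>, \<open>B\<close>, \<open>C\<close> are pairwise commuting and \<open>B\<close>, \<open>C\<close> have finitely many
  orbits, then a finite index subgroup of \<open>A\<close> acts commutatively. As there are at least three vertices
  on level \<open>2\<close>, this makes a finite index subgroup \<open>M\<close> of \<open>G\<close> act commutatively. But \<open>M\<close> has finitely
  many orbits on pairs of points, and only finite sets admit such an action of a commutative group.
\<close>

section \<open>Subgroups of finite index\<close>

text \<open>Finite index is witnessed by explicit representatives of right cosets rather than by a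
  number. Such witnesses can be multiplied together (for towers and products of subgroups) and
  applied to points (for counting orbits).\<close>

definition finite_index_in :: "('g, 'm) monoid_scheme \<Rightarrow> 'g set \<Rightarrow> 'g set \<Rightarrow> bool" where
  "finite_index_in G H K \<longleftrightarrow>
     (\<exists>F. finite F \<and> F \<subseteq> K \<and> (\<forall>k\<in>K. \<exists>h\<in>H. \<exists>f\<in>F. k = h \<otimes>\<^bsub>G\<^esub> f))"

lemma (in group) finite_index_in_trans:
  assumes "finite_index_in G H K" "finite_index_in G K L" "H \<subseteq> carrier G" "K \<subseteq> L" "subgroup L G"
  shows "finite_index_in G H L"
proof -
  obtain F where F: "finite F" "F \<subseteq> K" "\<And>k. k \<in> K \<Longrightarrow> \<exists>h\<in>H. \<exists>f\<in>F. k = h \<otimes> f"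
    using assms(1) unfolding finite_index_in_def by metis
  obtain F' where F': "finite F'" "F' \<subseteq> L" "\<And>l. l \<in> L \<Longrightarrow> \<exists>k\<in>K. \<exists>f\<in>F'. l = k \<otimes> f"
    using assms(2) unfolding finite_index_in_def by metis
  have LG: "L \<subseteq> carrier G" using assms(5) subgroup.subset by blast
  let ?F = "(\<lambda>(a, b). a \<otimes> b) ` (F \<times> F')"
  have "finite ?F" using F(1) F'(1) by simp
  moreover have "?F \<subseteq> L"
    using F(2) F'(2) assms(4) subgroup.m_closed[OF assms(5)] by (auto simp: subset_iff)
  moreover have "\<exists>h\<in>H. \<exists>f\<in>?F. l = h \<otimes> f" if l: "l \<in> L" for l
  proof -
    obtain k f' where k: "k \<in> K" "f' \<in> F'" "l = k \<otimes> f'" using F'(3)[OF l] by blast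
    obtain h f where h: "h \<in> H" "f \<in> F" "k = h \<otimes> f" using F(3)[OF k(1)] by blast
    have "h \<in> carrier G" "f \<in> carrier G" "f' \<in> carrier G"
      using h(1,2) k(2) F(2) F'(2) LG assms(3,4) by (auto simp: subset_iff)
    then have "l = h \<otimes> (f \<otimes> f')" using k h by (simp add: m_assoc)
    moreover have "f \<otimes> f' \<in> ?F" using h(2) k(2) by (auto intro: rev_image_eqI)
    ultimately show ?thesis using h(1) by blast
  qed
  ultimately show ?thesis unfolding finite_index_in_def by metis
qed

lemma (in group) commute_generate:
  assumes "S \<subseteq> carrier G" "g \<in> carrier G" "\<And>s. s \<in> S \<Longrightarrow> s \<otimes> g = g \<otimes> s"
    and "h \<in> generate G S"
  shows "h \<otimes> g = g \<otimes> h"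
  using assms(4)
proof (induction h rule: generate.induct)
  case one
  then show ?case using assms(2) by simp
next
  case (incl h)
  then show ?case by (rule assms(3))
next
  case (inv h)
  then have h: "h \<in> carrier G" "h \<otimes> g = g \<otimes> h" using assms(1,3) by blast+
  have "inv h \<otimes> g = inv h \<otimes> (g \<otimes> h) \<otimes> inv h"
    using h(1) assms(2) by (simp add: m_assoc)
  also have "\<dots> = inv h \<otimes> (h \<otimes> g) \<otimes> inv h" by (simp only: h(2))
  also have "\<dots> = g \<otimes> inv h"
    using h(1) assms(2) by (simp add: m_assoc[symmetric])
  finally show ?case .
next
  case (eng h1 h2)
  then have c: "h1 \<in> carrier G" "h2 \<in> carrier G"
    using generate_in_carrier[OF assms(1)] by auto
  have "(h1 \<otimes> h2) \<otimes> g = h1 \<otimes> (h2 \<otimes> g)" using c assms(2) by (simp add: m_assoc)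
  also have "\<dots> = (h1 \<otimes> g) \<otimes> h2" unfolding eng.IH(2) using c assms(2) by (simp add: m_assoc)
  also have "\<dots> = g \<otimes> (h1 \<otimes> h2)" unfolding eng.IH(1) using c assms(2) by (simp add: m_assoc)
  finally show ?case .
qed

lemma (in group) mult_commuting_subgroups:
  assumes H: "subgroup H G" and K: "subgroup K G"
    and comm: "\<And>h k. h \<in> H \<Longrightarrow> k \<in> K \<Longrightarrow> h \<otimes> k = k \<otimes> h"
  shows "subgroup (H <#> K) G"
proof -
  have HG: "H \<subseteq> carrier G" and KG: "K \<subseteq> carrier G"
    using H K subgroup.subset by blast+
  show ?thesis
  proof (rule subgroupI)
    show "H <#> K \<subseteq> carrier G" using HG KG by (rule set_mult_closed)
    show "H <#> K \<noteq> {}"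
      using subgroup.one_closed[OF H] subgroup.one_closed[OF K] unfolding set_mult_def by blast
  next
    fix x assume "x \<in> H <#> K"
    then obtain h k where x: "h \<in> H" "k \<in> K" "x = h \<otimes> k" unfolding set_mult_def by blast
    have c: "h \<in> carrier G" "k \<in> carrier G" using x HG KG by blast+
    have i: "inv h \<in> H" "inv k \<in> K"
      using x subgroup.m_inv_closed[OF H] subgroup.m_inv_closed[OF K] by blast+
    have "inv x = inv h \<otimes> inv k"
      using comm[OF i] by (simp add: x(3) c inv_mult_group)
    then show "inv x \<in> H <#> K" using i unfolding set_mult_def by blast
    fix y assume "y \<in> H <#> K"
    then obtain h' k' where y: "h' \<in> H" "k' \<in> K" "y = h' \<otimes> k'" unfolding set_mult_def by blast
    have c': "h' \<in> carrier G" "k' \<in> carrier G" using y HG KG by blast+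
    have "x \<otimes> y = h \<otimes> (k \<otimes> h') \<otimes> k'" using c c' by (simp add: x(3) y(3) m_assoc)
    also have "\<dots> = (h \<otimes> h') \<otimes> (k \<otimes> k')"
      unfolding comm[OF y(1) x(2), symmetric] using c c' by (simp add: m_assoc)
    finally show "x \<otimes> y \<in> H <#> K"
      using subgroup.m_closed[OF H x(1) y(1)] subgroup.m_closed[OF K x(2) y(2)]
      unfolding set_mult_def by blast
  qed
qed

text \<open>The products of the two sets of representatives represent the product: in
  \<open>(h' f)(k' f')\<close> the elements \<open>f\<close> and \<open>k'\<close> commute, which
  gives \<open>(h' k')(f f')\<close>.\<close>

lemma (in group) finite_index_in_commuting_mult:
  assumes H: "subgroup H G" and K: "subgroup K G"
    and comm: "\<And>h k. h \<in> H \<Longrightarrow> k \<in> K \<Longrightarrow> h \<otimes> k = k \<otimes> h"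
    and H': "H' \<subseteq> H" "finite_index_in G H' H" and K': "K' \<subseteq> K" "finite_index_in G K' K"
  shows "finite_index_in G (H' <#> K') (H <#> K)"
proof -
  have HG: "H \<subseteq> carrier G" and KG: "K \<subseteq> carrier G"
    using H K subgroup.subset by blast+
  obtain F where F: "finite F" "F \<subseteq> H" "\<And>k. k \<in> H \<Longrightarrow> \<exists>h\<in>H'. \<exists>f\<in>F. k = h \<otimes> f"
    using H'(2) unfolding finite_index_in_def by metis
  obtain F' where F': "finite F'" "F' \<subseteq> K" "\<And>l. l \<in> K \<Longrightarrow> \<exists>k\<in>K'. \<exists>f\<in>F'. l = k \<otimes> f"
    using K'(2) unfolding finite_index_in_def by metis
  have "finite (F <#> F')"
    using F(1) F'(1) unfolding set_mult_def by simp
  moreover have "F <#> F' \<subseteq> H <#> K"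
    using F(2) F'(2) unfolding set_mult_def by blast
  moreover have "\<exists>h \<in> H' <#> K'. \<exists>f \<in> F <#> F'. x = h \<otimes> f" if x: "x \<in> H <#> K" for x
  proof -
    obtain h k where hk: "h \<in> H" "k \<in> K" "x = h \<otimes> k"
      using x unfolding set_mult_def by blast
    obtain h' f where h: "h' \<in> H'" "f \<in> F" "h = h' \<otimes> f" using F(3)[OF hk(1)] by blast
    obtain k' f' where k: "k' \<in> K'" "f' \<in> F'" "k = k' \<otimes> f'" using F'(3)[OF hk(2)] by blast
    have c: "h' \<in> carrier G" "f \<in> carrier G" "k' \<in> carrier G" "f' \<in> carrier G"
      using h k F(2) F'(2) HG KG H'(1) K'(1) by blast+
    have fk: "f \<otimes> k' = k' \<otimes> f" using comm h(2) k(1) F(2) K'(1) by blast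
    have "x = h' \<otimes> (f \<otimes> k') \<otimes> f'" using hk h k c by (simp add: m_assoc)
    also have "\<dots> = (h' \<otimes> k') \<otimes> (f \<otimes> f')" unfolding fk using c by (simp add: m_assoc)
    finally show ?thesis using h k unfolding set_mult_def by blast
  qed
  ultimately show ?thesis unfolding finite_index_in_def by metis
qed

text \<open>Splits one factor off the subgroup generated by a commuting family, so that such
  subgroups can be treated by induction on the number of factors. The product on the right is a
  subgroup because \<open>H\<close> also centralizes all of \<open>generate G S\<close>.\<close>

lemma (in group) generate_commuting_Un:
  assumes H: "subgroup H G" and S: "S \<subseteq> carrier G"
    and comm: "\<And>h s. h \<in> H \<Longrightarrow> s \<in> S \<Longrightarrow> h \<otimes> s = s \<otimes> h"
  shows "generate G (H \<union> S) = H <#> generate G S"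
proof -
  have HG: "H \<subseteq> carrier G" using H subgroup.subset by blast
  have sub: "subgroup (H <#> generate G S) G"
  proof (rule mult_commuting_subgroups[OF H generate_is_subgroup[OF S]])
    fix h k assume "h \<in> H" "k \<in> generate G S"
    then show "h \<otimes> k = k \<otimes> h"
      using commute_generate[OF S, of h k] HG comm by fastforce
  qed
  have "H \<subseteq> H <#> generate G S"
  proof
    fix h assume "h \<in> H"
    then have "h = h \<otimes> \<one>" using HG r_one by (metis subsetD)
    then show "h \<in> H <#> generate G S"
      using \<open>h \<in> H\<close> generate.one unfolding set_mult_def by blast
  qed
  moreover have "S \<subseteq> H <#> generate G S"
  proof
    fix s assume "s \<in> S"
    then have "s = \<one> \<otimes> s" using S l_one by (metis subsetD)
    then show "s \<in> H <#> generate G S"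
      using generate.incl[OF \<open>s \<in> S\<close>] subgroup.one_closed[OF H] unfolding set_mult_def by blast
  qed
  ultimately have "generate G (H \<union> S) \<subseteq> H <#> generate G S"
    using generate_subgroup_incl[OF _ sub] by simp
  moreover have "H <#> generate G S \<subseteq> generate G (H \<union> S)"
  proof
    fix x assume "x \<in> H <#> generate G S"
    then obtain h k where "h \<in> H" "k \<in> generate G S" "x = h \<otimes> k"
      unfolding set_mult_def by blast
    moreover have "generate G S \<subseteq> generate G (H \<union> S)" by (rule mono_generate) simp
    ultimately show "x \<in> generate G (H \<union> S)"
      using generate.incl[of h "H \<union> S" G] by (auto intro: generate.eng)
  qed
  ultimately show ?thesis by blast
qed

text \<open>Translates the index condition of \<open>branch_group\<close>: choosing one
  representative for each of the finitely many cosets gives the set demanded by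
  \<open>finite_index_in\<close>.\<close>

lemma (in group) finite_index_in_if_finite_rcosets:
  assumes N: "subgroup N G" and fin: "finite (rcosets N)"
  shows "finite_index_in G N (carrier G)"
proof -
  have "rcosets N = (\<lambda>a. N #> a) ` carrier G" unfolding RCOSETS_def by blast
  then obtain F where F: "F \<subseteq> carrier G" "finite F" "(\<lambda>a. N #> a) ` carrier G = (\<lambda>a. N #> a) ` F"
    using fin finite_subset_image by (metis subset_refl)
  have "\<exists>h\<in>N. \<exists>f\<in>F. g = h \<otimes> f" if g: "g \<in> carrier G" for g
  proof -
    obtain f where f: "f \<in> F" "N #> g = N #> f" using F(3) g by blast
    have "g \<in> N #> f" using rcos_self[OF g N] f(2) by simp
    then show ?thesis using f(1) unfolding r_coset_def by blast
  qed
  then show ?thesis unfolding finite_index_in_def using F(1,2) by metis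
qed

section \<open>Commuting subgroups with finitely many orbits\<close>

context group_action
begin

interpretation group G
  using group_hom group_hom.axioms(1) by blast

definition sub_orbit :: "'a set \<Rightarrow> 'c \<Rightarrow> 'c set" where
  "sub_orbit H x = (\<lambda>h. \<phi> h x) ` H"

definition finitely_many_orbits :: "'a set \<Rightarrow> bool" where
  "finitely_many_orbits H \<longleftrightarrow> (\<exists>X. finite X \<and> X \<subseteq> E \<and> E \<subseteq> (\<Union>x\<in>X. sub_orbit H x))"

text \<open>When \<open>H\<close> commutes with \<open>C\<close>, it permutes the
  \<open>C\<close>-orbits, and this is the kernel of that permutation action.\<close>

definition orbit_kernel :: "'a set \<Rightarrow> 'a set \<Rightarrow> 'a set" where
  "orbit_kernel H C = {h \<in> H. \<forall>x\<in>E. \<phi> h x \<in> sub_orbit C x}"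

section \<open>Orbits of subgroups and kernels on sets of orbits\<close>

lemma action_one: "x \<in> E \<Longrightarrow> \<phi> \<one> x = x"
  by (metis id_eq_one restrict_apply')

lemma action_closed: "g \<in> carrier G \<Longrightarrow> x \<in> E \<Longrightarrow> \<phi> g x \<in> E"
  using element_image by blast

lemma action_inv: "g \<in> carrier G \<Longrightarrow> x \<in> E \<Longrightarrow> \<phi> (inv g) (\<phi> g x) = x"
  using orbit_sym_aux by blast

lemma action_inv': "g \<in> carrier G \<Longrightarrow> x \<in> E \<Longrightarrow> \<phi> g (\<phi> (inv g) x) = x"
  using action_inv[of "inv g" x] by simp

lemma sub_orbit_self: "subgroup H G \<Longrightarrow> x \<in> E \<Longrightarrow> x \<in> sub_orbit H x"
  unfolding sub_orbit_def using subgroup.one_closed action_one by (metis imageI)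

lemma sub_orbit_closed: "subgroup H G \<Longrightarrow> x \<in> E \<Longrightarrow> sub_orbit H x \<subseteq> E"
  unfolding sub_orbit_def using action_closed by (auto dest: subgroup.mem_carrier)

lemma sub_orbit_trans:
  assumes H: "subgroup H G" and x: "x \<in> E" and y: "y \<in> sub_orbit H x" and z: "z \<in> sub_orbit H y"
  shows "z \<in> sub_orbit H x"
proof -
  obtain h k where hk: "h \<in> H" "y = \<phi> h x" "k \<in> H" "z = \<phi> k y"
    using y z unfolding sub_orbit_def by blast
  then have "z = \<phi> (k \<otimes> h) x"
    using composition_rule x subgroup.mem_carrier[OF H] by metis
  then show ?thesis unfolding sub_orbit_def using hk subgroup.m_closed[OF H] by blast
qed

lemma sub_orbit_sym:
  assumes H: "subgroup H G" and x: "x \<in> E" and y: "y \<in> sub_orbit H x"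
  shows "x \<in> sub_orbit H y"
proof -
  obtain h where h: "h \<in> H" "y = \<phi> h x" using y unfolding sub_orbit_def by blast
  then have "x = \<phi> (inv h) y" using action_inv x subgroup.mem_carrier[OF H] by metis
  then show ?thesis unfolding sub_orbit_def using h subgroup.m_inv_closed[OF H] by blast
qed

lemma subgroup_orbit_kernel:
  assumes H: "subgroup H G" and C: "subgroup C G"
  shows "subgroup (orbit_kernel H C) G"
proof (rule subgroupI)
  have HG: "\<And>h. h \<in> H \<Longrightarrow> h \<in> carrier G" by (rule subgroup.mem_carrier[OF H])
  show "orbit_kernel H C \<subseteq> carrier G" using HG unfolding orbit_kernel_def by blast
  have "\<one> \<in> orbit_kernel H C"
    unfolding orbit_kernel_def
    using subgroup.one_closed[OF H] sub_orbit_self[OF C] action_one by simp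
  then show "orbit_kernel H C \<noteq> {}" by blast
next
  have HG: "\<And>h. h \<in> H \<Longrightarrow> h \<in> carrier G" by (rule subgroup.mem_carrier[OF H])
  fix a assume a: "a \<in> orbit_kernel H C"
  then have aH: "a \<in> H" and ax: "\<And>x. x \<in> E \<Longrightarrow> \<phi> a x \<in> sub_orbit C x"
    unfolding orbit_kernel_def by auto
  have "\<phi> (inv a) x \<in> sub_orbit C x" if x: "x \<in> E" for x
  proof -
    have y: "\<phi> (inv a) x \<in> E" using action_closed HG aH x by simp
    then have "x \<in> sub_orbit C (\<phi> (inv a) x)"
      using ax[OF y] action_inv'[OF HG[OF aH] x] by simp
    then show ?thesis using sub_orbit_sym[OF C y] by blast
  qed
  then show "inv a \<in> orbit_kernel H C"
    unfolding orbit_kernel_def using subgroup.m_inv_closed[OF H aH] by blast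
  fix b assume b: "b \<in> orbit_kernel H C"
  then have bH: "b \<in> H" and bx: "\<And>x. x \<in> E \<Longrightarrow> \<phi> b x \<in> sub_orbit C x"
    unfolding orbit_kernel_def by auto
  have "\<phi> (a \<otimes> b) x \<in> sub_orbit C x" if x: "x \<in> E" for x
    using sub_orbit_trans[OF C x bx[OF x]] ax action_closed[OF HG[OF bH] x]
      composition_rule[OF x HG[OF aH] HG[OF bH]] by metis
  then show "a \<otimes> b \<in> orbit_kernel H C"
    unfolding orbit_kernel_def using subgroup.m_closed[OF H aH bH] by blast
qed

lemma commute_action:
  assumes "a \<in> carrier G" "b \<in> carrier G" "a \<otimes> b = b \<otimes> a" "x \<in> E"
  shows "\<phi> a (\<phi> b x) = \<phi> b (\<phi> a x)"
  using assms composition_rule by metis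

text \<open>An \<open>H\<close> commuting with \<open>C\<close> permutes the finitely many
  \<open>C\<close>-orbits, so the kernel of the induced map to a finite symmetric group has finite
  index. The proof compares elements by where they send the orbit representatives.\<close>

lemma finite_index_orbit_kernel:
  assumes H: "subgroup H G" and C: "subgroup C G" and fo: "finitely_many_orbits C"
    and comm: "\<And>h c. h \<in> H \<Longrightarrow> c \<in> C \<Longrightarrow> h \<otimes> c = c \<otimes> h"
  shows "finite_index_in G (orbit_kernel H C) H"
proof -
  have HG: "\<And>h. h \<in> H \<Longrightarrow> h \<in> carrier G" by (rule subgroup.mem_carrier[OF H])
  have CG: "\<And>h. h \<in> C \<Longrightarrow> h \<in> carrier G" by (rule subgroup.mem_carrier[OF C])
  obtain X where X: "finite X" "X \<subseteq> E" "E \<subseteq> (\<Union>x\<in>X. sub_orbit C x)"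
    using fo unfolding finitely_many_orbits_def by blast
  define rep where "rep y = (SOME x. x \<in> X \<and> y \<in> sub_orbit C x)" for y
  have rep: "rep y \<in> X" "y \<in> sub_orbit C (rep y)" if "y \<in> E" for y
    using someI_ex[of "\<lambda>x. x \<in> X \<and> y \<in> sub_orbit C x"] that X unfolding rep_def by blast+
  \<comment> \<open>\<open>p h\<close> is the map induced by \<open>h\<close> on the chosen
    representatives of the \<open>C\<close>-orbits. Only finitely many maps can occur, and
    \<open>F\<close> picks one element of \<open>H\<close> for each.\<close>
  define p where "p h = (\<lambda>x\<in>X. rep (\<phi> h x))" for h
  have "p ` H \<subseteq> X \<rightarrow>\<^sub>E X"
    using rep(1) action_closed HG X(2) unfolding p_def by (auto simp: subset_iff)
  then have "finite (p ` H)" using X(1) by (meson finite_PiE finite_subset)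
  then obtain F where F: "F \<subseteq> H" "finite F" "p ` H = p ` F"
    using finite_subset_image by (metis subset_refl)
  have "\<exists>h\<in>orbit_kernel H C. \<exists>f\<in>F. k = h \<otimes> f" if k: "k \<in> H" for k
  proof -
    obtain f where f: "f \<in> F" "p k = p f" using F(3) k by blast
    have fH: "f \<in> H" using f F by blast
    have onX: "\<phi> k x \<in> sub_orbit C (\<phi> f x)" if x: "x \<in> X" for x
    proof -
      have xE: "x \<in> E" using x X by blast
      have "rep (\<phi> k x) = rep (\<phi> f x)" using fun_cong[OF f(2), of x] x unfolding p_def by simp
      then show ?thesis
        using rep action_closed[OF HG[OF k] xE] action_closed[OF HG[OF fH] xE]
          sub_orbit_sym[OF C] sub_orbit_trans[OF C] X(2) by (metis subsetD)
    qed
    have onE: "\<phi> k y \<in> sub_orbit C (\<phi> f y)" if y: "y \<in> E" for y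
    proof -
      obtain x c where xc: "x \<in> X" "c \<in> C" "y = \<phi> c x"
        using X(3) y unfolding sub_orbit_def by blast
      have xE: "x \<in> E" using xc X by blast
      obtain c' where c': "c' \<in> C" "\<phi> k x = \<phi> c' (\<phi> f x)"
        using onX[OF xc(1)] unfolding sub_orbit_def by blast
      \<comment> \<open>Agreement of \<open>k\<close> and \<open>f\<close> modulo \<open>C\<close>
        passes from \<open>x\<close> to \<open>y = c x\<close>: since \<open>k\<close> and
        \<open>f\<close> commute with \<open>c\<close>, the correcting factor \<open>c'\<close> is
        just conjugated by \<open>c\<close>.\<close>
      let ?d = "c \<otimes> c' \<otimes> inv c"
      have fx: "\<phi> f x \<in> E" using action_closed HG fH xE by blast
      have "\<phi> k y = \<phi> c (\<phi> k x)"
        using commute_action[OF HG CG comm] k xc xE by blast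
      also have "\<dots> = \<phi> (c \<otimes> c') (\<phi> f x)"
        using c' xc CG composition_rule fx by metis
      also have "\<dots> = \<phi> ?d (\<phi> c (\<phi> f x))"
        using composition_rule[of "\<phi> f x" ?d c] fx CG xc c' by (simp add: m_assoc)
      also have "\<phi> c (\<phi> f x) = \<phi> f y"
        using commute_action[OF HG CG comm] fH xc xE by metis
      finally show ?thesis
        using c'(1) xc(2) C unfolding sub_orbit_def
        by (blast intro: subgroup.m_closed subgroup.m_inv_closed)
    qed
    \<comment> \<open>\<open>k\<close> and \<open>f\<close> send each point into the same
      \<open>C\<close>-orbit, so \<open>k f^-1\<close> preserves every
      \<open>C\<close>-orbit.\<close>
    let ?h = "k \<otimes> inv f"
    have "\<phi> ?h x \<in> sub_orbit C x" if x: "x \<in> E" for x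
      using onE[of "\<phi> (inv f) x"] action_inv'[OF HG[OF fH] x] action_closed[OF _ x]
        composition_rule[OF x HG[OF k]] HG[OF fH] by (metis inv_closed)
    then have "?h \<in> orbit_kernel H C"
      unfolding orbit_kernel_def using H k fH
      by (blast intro: subgroup.m_closed subgroup.m_inv_closed)
    moreover have "k = ?h \<otimes> f" using HG k fH by (simp add: m_assoc)
    ultimately show ?thesis using f(1) by blast
  qed
  then show ?thesis unfolding finite_index_in_def using F by blast
qed

text \<open>If \<open>F\<close> represents the cosets of \<open>K\<close> in \<open>H\<close>, each
  orbit \<open>H x\<close> is covered by the \<open>K\<close>-orbits of the points
  \<open>f x\<close> with \<open>f\<close> in \<open>F\<close>.\<close>

lemma finitely_many_orbits_finite_index:
  assumes fo: "finitely_many_orbits H" and co: "finite_index_in G K H"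
    and H: "H \<subseteq> carrier G" and K: "K \<subseteq> carrier G"
  shows "finitely_many_orbits K"
proof -
  obtain X where X: "finite X" "X \<subseteq> E" "E \<subseteq> (\<Union>x\<in>X. sub_orbit H x)"
    using fo unfolding finitely_many_orbits_def by blast
  obtain F where F: "finite F" "F \<subseteq> H" "\<And>k. k \<in> H \<Longrightarrow> \<exists>h\<in>K. \<exists>f\<in>F. k = h \<otimes> f"
    using co unfolding finite_index_in_def by metis
  let ?X = "(\<lambda>(f, x). \<phi> f x) ` (F \<times> X)"
  have "y \<in> (\<Union>x\<in>?X. sub_orbit K x)" if y: "y \<in> E" for y
  proof -
    obtain x h where xh: "x \<in> X" "h \<in> H" "y = \<phi> h x"
      using X(3) y unfolding sub_orbit_def by blast
    obtain k f where kf: "k \<in> K" "f \<in> F" "h = k \<otimes> f" using F(3)[OF xh(2)] by blast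
    then have "y = \<phi> k (\<phi> f x)" using composition_rule xh X F H K by (metis subsetD)
    then have "y \<in> sub_orbit K (\<phi> f x)" unfolding sub_orbit_def using kf by blast
    then show ?thesis using kf xh by force
  qed
  moreover have "?X \<subseteq> E" using action_closed F(2) X(2) H by (auto simp: subset_iff)
  moreover have "finite ?X" using X F by simp
  ultimately show ?thesis unfolding finitely_many_orbits_def by blast
qed

text \<open>The image of \<open>H\<close> in the symmetric group is commutative. The action need not
  be faithful, so \<open>H\<close> itself may fail to be.\<close>

definition acts_commutatively :: "'a set \<Rightarrow> bool" where
  "acts_commutatively H \<longleftrightarrow> (\<forall>g\<in>H. \<forall>h\<in>H. \<forall>x\<in>E. \<phi> g (\<phi> h x) = \<phi> h (\<phi> g x))"

text \<open>If \<open>a x = b x\<close> with \<open>b\<close> preserving every \<open>C\<close>-orbit and commuting with \<open>a'\<close>, then \<open>a\<close> and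
  \<open>b\<close> agree on the whole orbit \<open>C x\<close>, which contains \<open>a' x\<close>; so \<open>a a' x = b a' x = a' b x = a' a x\<close>.\<close>

lemma acts_commutatively_orbit_kernel:
  assumes A: "subgroup A G" and B: "subgroup B G" and C: "subgroup C G"
    and AB: "\<And>a b. a \<in> A \<Longrightarrow> b \<in> B \<Longrightarrow> a \<otimes> b = b \<otimes> a"
    and AC: "\<And>a c. a \<in> A \<Longrightarrow> c \<in> C \<Longrightarrow> a \<otimes> c = c \<otimes> a"
    and BC: "\<And>b c. b \<in> B \<Longrightarrow> c \<in> C \<Longrightarrow> b \<otimes> c = c \<otimes> b"
  shows "acts_commutatively (orbit_kernel A (orbit_kernel B C))"
  unfolding acts_commutatively_def
proof (intro ballI)
  have AG: "\<And>h. h \<in> A \<Longrightarrow> h \<in> carrier G" by (rule subgroup.mem_carrier[OF A])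
  have BG: "\<And>h. h \<in> B \<Longrightarrow> h \<in> carrier G" by (rule subgroup.mem_carrier[OF B])
  have CG: "\<And>h. h \<in> C \<Longrightarrow> h \<in> carrier G" by (rule subgroup.mem_carrier[OF C])
  fix a a' x assume a: "a \<in> orbit_kernel A (orbit_kernel B C)"
    and a': "a' \<in> orbit_kernel A (orbit_kernel B C)" and x: "x \<in> E"
  have aA: "a \<in> A" "a' \<in> A" using a a' unfolding orbit_kernel_def by auto
  obtain b where b: "b \<in> orbit_kernel B C" "\<phi> a x = \<phi> b x"
    using a x unfolding orbit_kernel_def[of A] sub_orbit_def by blast
  obtain b' where b': "b' \<in> orbit_kernel B C" "\<phi> a' x = \<phi> b' x"
    using a' x unfolding orbit_kernel_def[of A] sub_orbit_def by blast
  have bB: "b \<in> B" "b' \<in> B" using b b' unfolding orbit_kernel_def by auto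
  obtain c where c: "c \<in> C" "\<phi> b' x = \<phi> c x"
    using b' x unfolding orbit_kernel_def sub_orbit_def by blast
  have "\<phi> a (\<phi> a' x) = \<phi> c (\<phi> a x)"
    using commute_action[OF AG CG AC] aA c x b'(2) by metis
  also have "\<dots> = \<phi> b (\<phi> a' x)"
    using commute_action[OF BG CG BC] bB c x b b'(2) by metis
  also have "\<dots> = \<phi> a' (\<phi> a x)"
    using commute_action[OF AG BG AB] aA bB x b(2) by metis
  finally show "\<phi> a (\<phi> a' x) = \<phi> a' (\<phi> a x)" .
qed

text \<open>The kernel of \<open>B\<close> on the \<open>C\<close>-orbits has finite index in
  \<open>B\<close>, so it still has finitely many orbits. Hence the kernel of \<open>A\<close> on
  the orbits of that subgroup has finite index in \<open>A\<close>, and it acts commutatively by the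
  preceding lemma.\<close>

lemma finite_index_commutative_subgroup:
  assumes A: "subgroup A G" and B: "subgroup B G" and C: "subgroup C G"
    and AB: "\<And>a b. a \<in> A \<Longrightarrow> b \<in> B \<Longrightarrow> a \<otimes> b = b \<otimes> a"
    and AC: "\<And>a c. a \<in> A \<Longrightarrow> c \<in> C \<Longrightarrow> a \<otimes> c = c \<otimes> a"
    and BC: "\<And>b c. b \<in> B \<Longrightarrow> c \<in> C \<Longrightarrow> b \<otimes> c = c \<otimes> b"
    and foB: "finitely_many_orbits B" and foC: "finitely_many_orbits C"
  shows "\<exists>H. subgroup H G \<and> H \<subseteq> A \<and> finite_index_in G H A \<and> acts_commutatively H"
proof -
  let ?B = "orbit_kernel B C"
  have B': "subgroup ?B G" by (rule subgroup_orbit_kernel[OF B C])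
  have "finitely_many_orbits ?B"
    by (rule finitely_many_orbits_finite_index[OF foB finite_index_orbit_kernel[OF B C foC BC]])
      (use B B' subgroup.subset in blast)+
  then have "finite_index_in G (orbit_kernel A ?B) A"
    by (intro finite_index_orbit_kernel[OF A B'] AB) (auto simp: orbit_kernel_def)
  then show ?thesis
    using subgroup_orbit_kernel[OF A B'] acts_commutatively_orbit_kernel[OF A B C AB AC BC]
    unfolding orbit_kernel_def[of A] by blast
qed

text \<open>The analogue for orbits of B. H. Neumann's lemma on groups covered by finitely many cosets.\<close>

lemma covering_orbits:
  assumes N: "subgroup N G" and trans: "\<And>x y. x \<in> E \<Longrightarrow> y \<in> E \<Longrightarrow> \<exists>n\<in>N. \<phi> n x = y"
    and ne: "E \<noteq> {}"
    and "finite J" and "\<And>i. i \<in> J \<Longrightarrow> subgroup (L i) G"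
    and "\<And>i n l. i \<in> J \<Longrightarrow> n \<in> N \<Longrightarrow> l \<in> L i \<Longrightarrow> n \<otimes> l \<otimes> inv n \<in> L i"
    and "finite X" "X \<subseteq> J \<times> E" "E \<subseteq> (\<Union>(i, x)\<in>X. sub_orbit (L i) x)"
  shows "\<exists>i\<in>J. finitely_many_orbits (L i)"
  using assms(4-)
proof (induction J arbitrary: X rule: finite_induct)
  case empty
  then show ?case using ne by auto
next
  case (insert i J)
  have Li: "subgroup (L i) G" using insert.prems by blast
  \<comment> \<open>The induction removes \<open>L i\<close> from the cover: \<open>Y\<close>
    collects the base points of the \<open>L i\<close>-orbits used, \<open>Z\<close> the remaining
    part of the cover.\<close>
  define Y where "Y = {x. (i, x) \<in> X}"
  define Z where "Z = X \<inter> (J \<times> E)"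
  have "Y \<subseteq> snd ` X" unfolding Y_def by force
  then have finY: "finite Y" using insert.prems(3) finite_subset by blast
  have YE: "Y \<subseteq> E" unfolding Y_def using insert.prems(4) by blast
  show ?case
  proof (cases "E \<subseteq> (\<Union>x\<in>Y. sub_orbit (L i) x)")
    case True
    then show ?thesis unfolding finitely_many_orbits_def using finY YE by blast
  next
    case False
    \<comment> \<open>Distinct \<open>L i\<close>-orbits are disjoint, so the whole
      \<open>L i\<close>-orbit of a point \<open>d\<close> missed by \<open>Y\<close> must be
      covered by the orbits from \<open>Z\<close>.\<close>
    then obtain d where d: "d \<in> E" "\<And>x. x \<in> Y \<Longrightarrow> d \<notin> sub_orbit (L i) x" by blast
    have cov: "(\<exists>x\<in>Y. z \<in> sub_orbit (L i) x) \<or> (\<exists>(j, x)\<in>Z. z \<in> sub_orbit (L j) x)"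
      if "z \<in> E" for z
      using insert.prems(4,5) that unfolding Y_def Z_def by fast
    have covd: "\<exists>(j, x)\<in>Z. z \<in> sub_orbit (L j) x" if z: "z \<in> sub_orbit (L i) d" for z
    proof -
      have zE: "z \<in> E" using z d(1) sub_orbit_closed[OF Li] by blast
      have "z \<notin> sub_orbit (L i) x" if "x \<in> Y" for x
        using d z sub_orbit_sym[OF Li d(1) z] sub_orbit_trans[OF Li] that YE by blast
      then show ?thesis using cov[OF zE] by blast
    qed
    \<comment> \<open>As \<open>N\<close> normalizes \<open>L i\<close>, the element
      \<open>n x\<close> carries the \<open>L i\<close>-orbit of \<open>d\<close> to that of
      \<open>x\<close>. Translating the cover of the former by \<open>n x\<close> therefore covers
      the latter, and as \<open>N\<close> normalizes every \<open>L j\<close> the translated pieces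
      are again \<open>L j\<close>-orbits. \<open>W\<close> adds these translates to
      \<open>Z\<close>.\<close>
    obtain n where n: "\<And>x. x \<in> Y \<Longrightarrow> n x \<in> N" "\<And>x. x \<in> Y \<Longrightarrow> \<phi> (n x) d = x"
      using trans[OF d(1)] YE by (metis subsetD)
    have nG: "\<And>x. x \<in> Y \<Longrightarrow> n x \<in> carrier G" using n(1) subgroup.mem_carrier[OF N] by blast
    define W where "W = Z \<union> (\<lambda>(x, j, y). (j, \<phi> (n x) y)) ` (Y \<times> Z)"
    have "finite Z" unfolding Z_def using insert.prems(3) by blast
    then have "finite W" unfolding W_def using finY by blast
    moreover have "W \<subseteq> J \<times> E"
      unfolding W_def Z_def using action_closed nG by auto
    moreover have "E \<subseteq> (\<Union>(j, x)\<in>W. sub_orbit (L j) x)"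
    proof
      fix z assume z: "z \<in> E"
      show "z \<in> (\<Union>(j, x)\<in>W. sub_orbit (L j) x)"
      proof (cases "\<exists>(j, x)\<in>Z. z \<in> sub_orbit (L j) x")
        case True
        then show ?thesis unfolding W_def by blast
      next
        case False
        then obtain x where x: "x \<in> Y" "z \<in> sub_orbit (L i) x" using cov[OF z] by blast
        have xE: "x \<in> E" using x YE by blast
        let ?n = "n x" and ?w = "\<phi> (inv (n x)) z"
        have nx: "?n \<in> carrier G" "?n \<in> N" "inv ?n \<in> N"
          using x(1) nG n(1) subgroup.m_inv_closed[OF N] by auto
        obtain k where k: "k \<in> L i" "z = \<phi> k x" using x(2) unfolding sub_orbit_def by blast
        have kG: "k \<in> carrier G" using k(1) by (rule subgroup.mem_carrier[OF Li])
        \<comment> \<open>Pull \<open>z\<close> back from the orbit of \<open>x\<close> to the orbit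
          of \<open>d\<close>, where \<open>covd\<close> applies. The resulting
          \<open>L j\<close>-orbit is pushed forward again below.\<close>
        have "\<phi> (inv ?n \<otimes> k \<otimes> inv (inv ?n)) d = ?w"
          using nx(1) kG d(1) n(2)[OF x(1)] k(2) xE
          by (simp add: composition_rule action_closed)
        then have "?w \<in> sub_orbit (L i) d"
          using insert.prems(2)[of i "inv ?n" k] k(1) nx(3)
          unfolding sub_orbit_def by (metis imageI insertI1)
        then obtain j y where jy: "(j, y) \<in> Z" "?w \<in> sub_orbit (L j) y" using covd by blast
        obtain l where l: "l \<in> L j" "?w = \<phi> l y" using jy(2) unfolding sub_orbit_def by blast
        have j: "j \<in> J" "y \<in> E" using jy(1) unfolding Z_def by auto
        have lG: "l \<in> carrier G" using l(1) j(1) insert.prems(1) subgroup.mem_carrier by (metis insertI2)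
        have "\<phi> (?n \<otimes> l \<otimes> inv ?n) (\<phi> ?n y) = \<phi> ?n (\<phi> l y)"
          using nx(1) lG j(2) by (simp add: composition_rule action_closed action_inv)
        also have "\<dots> = z" using action_inv'[OF nx(1) z] l(2) by simp
        finally have "z \<in> sub_orbit (L j) (\<phi> ?n y)"
          using insert.prems(2)[of j ?n l] j(1) nx(2) l(1)
          unfolding sub_orbit_def by (metis imageI insertI2)
        moreover have "(j, \<phi> ?n y) \<in> W" unfolding W_def using x(1) jy(1) by force
        ultimately show ?thesis by blast
      qed
    qed
    moreover have "\<And>i. i \<in> J \<Longrightarrow> subgroup (L i) G" using insert.prems(1) by blast
    moreover have "\<And>i n l. i \<in> J \<Longrightarrow> n \<in> N \<Longrightarrow> l \<in> L i \<Longrightarrow> n \<otimes> l \<otimes> inv n \<in> L i"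
      using insert.prems(2) by blast
    ultimately show ?thesis using insert.IH by blast
  qed
qed

section \<open>Commutatively acting subgroups of products\<close>

lemma acts_commutatively_mult:
  assumes H: "subgroup H G" and K: "subgroup K G"
    and comm: "\<And>h k. h \<in> H \<Longrightarrow> k \<in> K \<Longrightarrow> h \<otimes> k = k \<otimes> h"
    and aH: "acts_commutatively H" and aK: "acts_commutatively K"
  shows "acts_commutatively (H <#> K)"
  unfolding acts_commutatively_def
proof (intro ballI)
  have HG: "\<And>h. h \<in> H \<Longrightarrow> h \<in> carrier G" by (rule subgroup.mem_carrier[OF H])
  have KG: "\<And>h. h \<in> K \<Longrightarrow> h \<in> carrier G" by (rule subgroup.mem_carrier[OF K])
  fix a b x assume "a \<in> H <#> K" "b \<in> H <#> K" and x: "x \<in> E"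
  then obtain h k h' k' where a: "h \<in> H" "k \<in> K" "a = h \<otimes> k"
    and b: "h' \<in> H" "k' \<in> K" "b = h' \<otimes> k'"
    unfolding set_mult_def by blast
  have ab: "\<phi> a y = \<phi> h (\<phi> k y)" "\<phi> b y = \<phi> h' (\<phi> k' y)" if "y \<in> E" for y
    using that a b HG KG by (simp_all add: composition_rule)
  have kx: "\<phi> k x \<in> E" "\<phi> k' x \<in> E" using action_closed KG a b x by auto
  have swap: "\<phi> p (\<phi> q y) = \<phi> q (\<phi> p y)" if "p \<in> H" "q \<in> K" "y \<in> E" for p q y
    using commute_action[OF HG KG comm] that by blast
  have "\<phi> a (\<phi> b x) = \<phi> h (\<phi> k (\<phi> h' (\<phi> k' x)))"
    using ab x action_closed HG kx b(1) by metis
  also have "\<dots> = \<phi> h (\<phi> h' (\<phi> k (\<phi> k' x)))" using swap[OF b(1) a(2) kx(2)] by simp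
  also have "\<dots> = \<phi> h' (\<phi> h (\<phi> k' (\<phi> k x)))"
    using aH aK a b x kx(1) action_closed[OF KG[OF b(2)]] unfolding acts_commutatively_def by metis
  also have "\<dots> = \<phi> h' (\<phi> k' (\<phi> h (\<phi> k x)))" using swap[OF a(1) b(2) kx(1)] by simp
  also have "\<dots> = \<phi> b (\<phi> a x)"
    using ab x action_closed HG kx a(1) by metis
  finally show "\<phi> a (\<phi> b x) = \<phi> b (\<phi> a x)" .
qed

text \<open>Induction on \<open>J\<close>: the generated subgroup is a product of commuting factors,
  and the product of the finite index subgroups of the factors has finite index and acts
  commutatively.\<close>

lemma finite_index_commutative_generate:
  assumes "finite J" and "\<And>i. i \<in> J \<Longrightarrow> subgroup (L i) G"
    and "\<And>i j a b. i \<in> J \<Longrightarrow> j \<in> J \<Longrightarrow> i \<noteq> j \<Longrightarrow> a \<in> L i \<Longrightarrow> b \<in> L j \<Longrightarrow> a \<otimes> b = b \<otimes> a"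
    and "\<And>i. i \<in> J \<Longrightarrow>
      \<exists>H. subgroup H G \<and> H \<subseteq> L i \<and> finite_index_in G H (L i) \<and> acts_commutatively H"
  shows "\<exists>M. subgroup M G \<and> M \<subseteq> generate G (\<Union>i\<in>J. L i) \<and>
    finite_index_in G M (generate G (\<Union>i\<in>J. L i)) \<and> acts_commutatively M"
  using assms
proof (induction J rule: finite_induct)
  case empty
  have "finite_index_in G {\<one>} {\<one>}" unfolding finite_index_in_def by (intro exI[of _ "{\<one>}"]) auto
  moreover have "acts_commutatively {\<one>}" unfolding acts_commutatively_def by simp
  ultimately show ?case
    using generate_empty triv_subgroup by auto
next
  case (insert i J)
  let ?S = "\<Union>i\<in>J. L i"
  have Li: "subgroup (L i) G" using insert.prems(1) by blast
  have S: "?S \<subseteq> carrier G" using insert.prems(1) subgroup.subset by blast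
  have gS: "subgroup (generate G ?S) G" by (rule generate_is_subgroup[OF S])
  have cLS: "a \<otimes> s = s \<otimes> a" if "a \<in> L i" "s \<in> ?S" for a s
    using that insert.prems(2)[of i _ a s] insert.hyps(2) by auto
  have cLg: "a \<otimes> s = s \<otimes> a" if a: "a \<in> L i" and s: "s \<in> generate G ?S" for a s
    by (rule commute_generate[OF S _ _ s, symmetric])
      (use a cLS subgroup.mem_carrier[OF Li] in auto)
  obtain H where H: "subgroup H G" "H \<subseteq> L i" "finite_index_in G H (L i)" "acts_commutatively H"
    using insert.prems(3) by blast
  have "\<exists>M. subgroup M G \<and> M \<subseteq> generate G ?S \<and>
      finite_index_in G M (generate G ?S) \<and> acts_commutatively M"
    by (rule insert.IH) (use insert.prems in blast)+
  then obtain M where M: "subgroup M G" "M \<subseteq> generate G ?S"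
      "finite_index_in G M (generate G ?S)" "acts_commutatively M"
    by blast
  have HM: "h \<otimes> m = m \<otimes> h" if "h \<in> H" "m \<in> M" for h m
    using cLg H(2) M(2) that by blast
  have gen: "generate G (\<Union>i\<in>insert i J. L i) = L i <#> generate G ?S"
    using generate_commuting_Un[OF Li S cLS] by simp
  have "subgroup (H <#> M) G" by (rule mult_commuting_subgroups[OF H(1) M(1) HM])
  moreover have "H <#> M \<subseteq> L i <#> generate G ?S"
    using H(2) M(2) unfolding set_mult_def by blast
  moreover have "finite_index_in G (H <#> M) (L i <#> generate G ?S)"
    by (rule finite_index_in_commuting_mult[OF Li gS cLg H(2,3) M(2,3)])
  moreover have "acts_commutatively (H <#> M)"
    by (rule acts_commutatively_mult[OF H(1) M(1) HM H(4) M(4)])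
  ultimately show ?case unfolding gen by blast
qed

section \<open>Actions that are transitive on two-element sets\<close>

lemma n_set_transitive_2D:
  assumes "n_set_transitive G E \<phi> 2" "x \<in> E" "y \<in> E" "x \<noteq> y" "u \<in> E" "v \<in> E" "u \<noteq> v"
  obtains g where "g \<in> carrier G" "(\<phi> g x = u \<and> \<phi> g y = v) \<or> (\<phi> g x = v \<and> \<phi> g y = u)"
proof -
  have "\<exists>g\<in>carrier G. \<phi> g ` {x, y} = {u, v}"
    using assms unfolding n_set_transitive_def by (metis card_2_iff empty_subsetI
      finite.emptyI finite.insertI insert_subset)
  then show ?thesis using that assms(7) by (auto simp: doubleton_eq_iff)
qed

text \<open>A commutative group acts regularly on each of its orbits, so the element carrying \<open>x\<close> to \<open>y\<close>
  is determined by any pair \<open>(p, q)\<close> in the orbit of \<open>(x, y)\<close>; there are finitely many such orbits.\<close>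

lemma finite_if_finite_index_commutative:
  assumes nst: "n_set_transitive G E \<phi> 2" and M: "subgroup M G"
    and aM: "acts_commutatively M" and co: "finite_index_in G M (carrier G)"
  shows "finite E"
proof (cases "\<exists>x\<in>E. \<exists>y\<in>E. x \<noteq> y")
  case False
  then have "E = {} \<or> (\<exists>x. E = {x})" by blast
  then show ?thesis by auto
next
  case True
  then obtain x0 y0 where 0: "x0 \<in> E" "y0 \<in> E" "x0 \<noteq> y0" by blast
  have MG: "\<And>m. m \<in> M \<Longrightarrow> m \<in> carrier G" by (rule subgroup.mem_carrier[OF M])
  have Mcomm: "\<And>a b x. a \<in> M \<Longrightarrow> b \<in> M \<Longrightarrow> x \<in> E \<Longrightarrow> \<phi> a (\<phi> b x) = \<phi> b (\<phi> a x)"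
    using aM unfolding acts_commutatively_def by blast
  obtain F where F: "finite F" "F \<subseteq> carrier G"
      "\<And>g. g \<in> carrier G \<Longrightarrow> \<exists>m\<in>M. \<exists>f\<in>F. g = m \<otimes> f"
    using co unfolding finite_index_in_def by metis
  \<comment> \<open>Both orders are listed because 2-set-transitivity moves unordered pairs only. By
    \<open>pair\<close> below, the finite set \<open>P\<close> meets every \<open>M\<close>-orbit of
    ordered pairs of distinct points.\<close>
  define P where "P = (\<lambda>f. (\<phi> f x0, \<phi> f y0)) ` F \<union> (\<lambda>f. (\<phi> f y0, \<phi> f x0)) ` F"
  have finP: "finite P" unfolding P_def using F(1) by simp
  have PE: "p \<in> E" "q \<in> E" if "(p, q) \<in> P" for p q
    using that F(2) 0 action_closed unfolding P_def by (auto simp: subset_iff)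
  have pair: "\<exists>(p, q)\<in>P. \<exists>m\<in>M. x = \<phi> m p \<and> y = \<phi> m q"
    if xy: "x \<in> E" "y \<in> E" "x \<noteq> y" for x y
  proof -
    obtain g where g: "g \<in> carrier G"
      "(\<phi> g x0 = x \<and> \<phi> g y0 = y) \<or> (\<phi> g x0 = y \<and> \<phi> g y0 = x)"
      by (rule n_set_transitive_2D[OF nst 0 xy])
    obtain m f where mf: "m \<in> M" "f \<in> F" "g = m \<otimes> f" using F(3)[OF g(1)] by blast
    have fG: "f \<in> carrier G" using mf(2) F(2) by blast
    have "\<phi> g x0 = \<phi> m (\<phi> f x0)" "\<phi> g y0 = \<phi> m (\<phi> f y0)"
      unfolding mf(3) using 0 fG MG[OF mf(1)] by (simp_all add: composition_rule)
    then show ?thesis using g(2) mf(1,2) unfolding P_def by blast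
  qed
  have fin: "finite (sub_orbit M x)" if x: "x \<in> E" for x
  proof -
    let ?O = "sub_orbit M x - {x}"
    \<comment> \<open>\<open>?R y r\<close> says that \<open>(x, y)\<close> lies in the
      \<open>M\<close>-orbit of the pair \<open>r\<close> of \<open>P\<close>. Choosing such an
      \<open>r\<close> for each \<open>y\<close> will embed the orbit of \<open>x\<close>, without
      \<open>x\<close>, into \<open>P\<close>.\<close>
    let ?R = "\<lambda>y r. r \<in> P \<and> (\<exists>m\<in>M. x = \<phi> m (fst r) \<and> y = \<phi> m (snd r))"
    define c where "c y = (SOME r. ?R y r)" for y
    have c: "?R y (c y)" if y: "y \<in> ?O" for y
    proof -
      have "y \<in> E" "x \<noteq> y" using y sub_orbit_closed[OF M x] by auto
      then have "\<exists>r. ?R y r" using pair[OF x] by fastforce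
      then show ?thesis unfolding c_def by (rule someI_ex)
    qed
    have "inj_on c ?O"
    proof (rule inj_onI)
      fix y y' assume y: "y \<in> ?O" and y': "y' \<in> ?O" and eq: "c y = c y'"
      obtain p q where pq: "c y = (p, q)" by fastforce
      have pqE: "p \<in> E" "q \<in> E" using c[OF y] pq PE by auto
      obtain m where m: "m \<in> M" "x = \<phi> m p" "y = \<phi> m q" using c[OF y] pq by auto
      obtain m' where m': "m' \<in> M" "x = \<phi> m' p" "y' = \<phi> m' q" using c[OF y'] pq eq by auto
      obtain k where k: "k \<in> M" "y = \<phi> k x" using y unfolding sub_orbit_def by blast
      \<comment> \<open>With \<open>y = k x\<close>, cancelling \<open>m\<close> gives
        \<open>q = k p\<close>, so \<open>y' = m' k p = k m' p = k x = y\<close>.\<close>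
      have "\<phi> m q = \<phi> m (\<phi> k p)" using k m Mcomm pqE by metis
      then have "q = \<phi> k p"
        using action_inv[OF MG[OF m(1)]] action_closed[OF MG[OF k(1)]] pqE by metis
      then have "y' = \<phi> k x" using m'(2,3) Mcomm[OF m'(1) k(1) pqE(1)] by simp
      then show "y = y'" using k(2) by simp
    qed
    moreover have "c ` ?O \<subseteq> P" using c by blast
    ultimately have "finite ?O" using finP by (meson finite_imageD finite_subset)
    then show ?thesis by simp
  qed
  \<comment> \<open>Every point is the first entry of some pair of distinct points, so finitely many
    \<open>M\<close>-orbits, each finite, exhaust \<open>E\<close>.\<close>
  have "E \<subseteq> (\<Union>p\<in>fst ` P. sub_orbit M p)"
  proof
    fix x assume x: "x \<in> E"
    obtain y where "y \<in> E" "x \<noteq> y" using 0 by metis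
    then obtain p q m where "(p, q) \<in> P" "m \<in> M" "x = \<phi> m p" using pair[OF x] by blast
    then show "x \<in> (\<Union>p\<in>fst ` P. sub_orbit M p)" unfolding sub_orbit_def by force
  qed
  moreover have "finite (\<Union>p\<in>fst ` P. sub_orbit M p)"
    using finP fin PE by auto
  ultimately show ?thesis by (rule finite_subset)
qed

lemma sub_orbit_conj:
  assumes g: "g \<in> carrier G" and L: "L \<subseteq> carrier G" and x: "x \<in> E" and y: "y \<in> sub_orbit L x"
    and conj: "\<And>l. l \<in> L \<Longrightarrow> g \<otimes> l \<otimes> inv g \<in> K"
  shows "\<phi> g y \<in> sub_orbit K (\<phi> g x)"
proof -
  obtain l where l: "l \<in> L" "y = \<phi> l x" using y unfolding sub_orbit_def by blast
  then have "\<phi> (g \<otimes> l \<otimes> inv g) (\<phi> g x) = \<phi> g y"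
    using g x L by (simp add: composition_rule action_closed action_inv subset_iff)
  then show ?thesis unfolding sub_orbit_def using conj[OF l(1)] by (metis imageI)
qed

text \<open>The group-theoretic core, free of trees: \<open>I\<close> stands for a level and
  \<open>L i\<close> for the rigid stabilizers of its vertices. Conjugation is recorded by
  inclusions, which suffice because enlarging a subgroup only enlarges its orbits.\<close>

theorem no_2_set_transitive_action:
  assumes nst: "n_set_transitive G E \<phi> 2" and inf: "infinite E" and finI: "finite I"
    and three: "\<And>i. i \<in> I \<Longrightarrow> \<exists>j\<in>I. \<exists>k\<in>I. i \<noteq> j \<and> i \<noteq> k \<and> j \<noteq> k"
    and L: "\<And>i. i \<in> I \<Longrightarrow> subgroup (L i) G"
    and comm: "\<And>i j a b. i \<in> I \<Longrightarrow> j \<in> I \<Longrightarrow> i \<noteq> j \<Longrightarrow> a \<in> L i \<Longrightarrow> b \<in> L j \<Longrightarrow> a \<otimes> b = b \<otimes> a"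
    and conj: "\<And>g i. g \<in> carrier G \<Longrightarrow> i \<in> I \<Longrightarrow> \<exists>j\<in>I. \<forall>l\<in>L i. g \<otimes> l \<otimes> inv g \<in> L j"
    and trans: "\<And>i j. i \<in> I \<Longrightarrow> j \<in> I \<Longrightarrow> \<exists>g\<in>carrier G. \<forall>l\<in>L i. g \<otimes> l \<otimes> inv g \<in> L j"
    and co: "finite_index_in G (generate G (\<Union>i\<in>I. L i)) (carrier G)"
  shows False
proof -
  let ?N = "generate G (\<Union>i\<in>I. L i)"
  have LG: "L i \<subseteq> carrier G" if "i \<in> I" for i using L[OF that] subgroup.subset by blast
  then have UG: "(\<Union>i\<in>I. L i) \<subseteq> carrier G" by blast
  have N: "subgroup ?N G" by (rule generate_is_subgroup[OF UG])
  have NG: "\<And>n. n \<in> ?N \<Longrightarrow> n \<in> carrier G" by (rule subgroup.mem_carrier[OF N])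
  \<comment> \<open>Otherwise the finite index subgroup \<open>?N\<close> acts trivially, hence
    commutatively, and \<open>E\<close> is finite.\<close>
  have "\<exists>i\<in>I. \<exists>l\<in>L i. \<exists>x\<in>E. \<phi> l x \<noteq> x"
  proof (rule ccontr)
    assume "\<not> ?thesis"
    then have triv: "\<phi> l x = x" if "i \<in> I" "l \<in> L i" "x \<in> E" for i l x using that by blast
    have N1: "\<phi> n x = x" if "n \<in> ?N" "x \<in> E" for n x
      using that
    proof (induction n rule: generate.induct)
      case (inv h)
      then show ?case using triv UG action_inv by (metis UN_E subsetD)
    next
      case (eng h k)
      then show ?case using composition_rule NG by simp
    qed (use triv action_one in auto)
    have "acts_commutatively ?N"
      unfolding acts_commutatively_def using N1 by simp
    then show False using finite_if_finite_index_commutative[OF nst N _ co] inf by blast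
  qed
  then obtain i l x where ilx: "i \<in> I" "l \<in> L i" "x \<in> E" "\<phi> l x \<noteq> x" by blast
  \<comment> \<open>The pair \<open>{x, l x}\<close> lies in one \<open>L i\<close>-orbit. An
    element \<open>g\<close> moving it to \<open>{u, v}\<close> conjugates \<open>L i\<close> into
    some \<open>L j\<close>, and the symmetry of the orbit relation handles both orders.\<close>
  have cover: "\<exists>j\<in>I. v \<in> sub_orbit (L j) u" if uv: "u \<in> E" "v \<in> E" for u v
  proof (cases "u = v")
    case True
    then show ?thesis using ilx(1) sub_orbit_self[OF L] uv by blast
  next
    case False
    let ?y = "\<phi> l x"
    have y: "?y \<in> E" using action_closed LG ilx by blast
    have xy: "?y \<in> sub_orbit (L i) x" unfolding sub_orbit_def using ilx by blast
    have yx: "x \<in> sub_orbit (L i) ?y" by (rule sub_orbit_sym[OF L[OF ilx(1)] ilx(3) xy])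
    obtain g where g: "g \<in> carrier G"
      "(\<phi> g x = u \<and> \<phi> g ?y = v) \<or> (\<phi> g x = v \<and> \<phi> g ?y = u)"
      by (rule n_set_transitive_2D[OF nst ilx(3) y ilx(4)[symmetric] uv False])
    obtain j where j: "j \<in> I" "\<And>l. l \<in> L i \<Longrightarrow> g \<otimes> l \<otimes> inv g \<in> L j"
      using conj[OF g(1) ilx(1)] by blast
    show ?thesis
      using g(2) j(1) sub_orbit_conj[OF g(1) LG[OF ilx(1)] ilx(3) xy j(2)]
        sub_orbit_conj[OF g(1) LG[OF ilx(1)] y yx j(2)] by auto
  qed
  \<comment> \<open>A generator from \<open>L j\<close> normalizes \<open>L j\<close>, and one from
    another factor centralizes it.\<close>
  have normalize: "n \<otimes> a \<otimes> inv n \<in> L j" if "j \<in> I" "n \<in> ?N" "a \<in> L j" for j n a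
    using that(2,1,3)
  proof (induction n arbitrary: a rule: generate.induct)
    case one
    then show ?case using LG by (simp add: subset_iff)
  next
    case (incl h)
    then obtain k where k: "k \<in> I" "h \<in> L k" by blast
    show ?case
    proof (cases "k = j")
      case True
      then show ?thesis using k(2) incl L subgroup.m_closed subgroup.m_inv_closed by metis
    next
      case False
      then have "h \<otimes> a \<otimes> inv h = a"
        using comm[OF k(1) incl(2) _ k(2) incl(3)] k LG incl by (simp add: m_assoc subset_iff)
      then show ?thesis using incl by simp
    qed
  next
    case (inv h)
    then obtain k where k: "k \<in> I" "inv h \<in> L k" "h \<in> carrier G"
      using L subgroup.m_inv_closed UG by (metis UN_E subsetD)
    show ?case
    proof (cases "k = j")
      case True
      then show ?thesis using k(2) inv L subgroup.m_closed subgroup.m_inv_closed by metis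
    next
      case False
      then have "inv h \<otimes> a \<otimes> inv (inv h) = a"
        using comm[OF k(1) inv(2) _ k(2) inv(3)] k LG inv by (simp add: m_assoc subset_iff)
      then show ?thesis using inv by simp
    qed
  next
    case (eng h k)
    have "a \<in> carrier G" using eng.prems LG by blast
    then have "h \<otimes> k \<otimes> a \<otimes> inv (h \<otimes> k) = h \<otimes> (k \<otimes> a \<otimes> inv k) \<otimes> inv h"
      using NG[OF eng.hyps(1)] NG[OF eng.hyps(2)] by (simp add: m_assoc inv_mult_group)
    then show ?case using eng.IH eng.prems by simp
  qed
  have Ntrans: "\<exists>n\<in>?N. \<phi> n u = v" if "u \<in> E" "v \<in> E" for u v
    using cover[OF that] generate.incl[of _ "\<Union>i\<in>I. L i" G] unfolding sub_orbit_def by blast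
  have "\<exists>i\<in>I. finitely_many_orbits (L i)"
  \<comment> \<open>By \<open>cover\<close> with the first point fixed at \<open>x\<close>, the
    finitely many orbits \<open>L i x\<close> already cover \<open>E\<close>.\<close>
  proof (rule covering_orbits[where N = ?N and J = I and X = "I \<times> {x}", OF N])
    show "E \<subseteq> (\<Union>(i, x) \<in> I \<times> {x}. sub_orbit (L i) x)" using cover[OF ilx(3)] by auto
  qed (use finI ilx(3) L in \<open>auto intro: Ntrans normalize\<close>)
  then obtain i0 where i0: "i0 \<in> I" "finitely_many_orbits (L i0)" by blast
  obtain X where X: "finite X" "X \<subseteq> E" "E \<subseteq> (\<Union>x\<in>X. sub_orbit (L i0) x)"
    using i0(2) unfolding finitely_many_orbits_def by blast
  \<comment> \<open>Conjugation transports finiteness from \<open>i0\<close> to \<open>j\<close>: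
    \<open>g\<close> maps \<open>L i0\<close>-orbits into \<open>L j\<close>-orbits, so the
    translates of \<open>X\<close> by \<open>g\<close> serve as base points.\<close>
  have fo: "finitely_many_orbits (L j)" if j: "j \<in> I" for j
  proof -
    obtain g where g: "g \<in> carrier G" "\<And>l. l \<in> L i0 \<Longrightarrow> g \<otimes> l \<otimes> inv g \<in> L j"
      using trans[OF i0(1) j] by blast
    have "y \<in> (\<Union>x\<in>\<phi> g ` X. sub_orbit (L j) x)" if y: "y \<in> E" for y
    proof -
      have "\<phi> (inv g) y \<in> E" using action_closed g(1) y by simp
      then obtain x where x: "x \<in> X" "\<phi> (inv g) y \<in> sub_orbit (L i0) x" using X(3) by blast
      then have "\<phi> g (\<phi> (inv g) y) \<in> sub_orbit (L j) (\<phi> g x)"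
        using sub_orbit_conj[OF g(1) LG[OF i0(1)] _ x(2) g(2)] X(2) by blast
      then show ?thesis using x(1) action_inv'[OF g(1) y] by auto
    qed
    then show ?thesis
      unfolding finitely_many_orbits_def using X(1,2) action_closed[OF g(1)]
      by (intro exI[of _ "\<phi> g ` X"]) auto
  qed
  have "\<exists>H. subgroup H G \<and> H \<subseteq> L i \<and> finite_index_in G H (L i) \<and> acts_commutatively H"
    if i: "i \<in> I" for i
  proof -
    obtain j k where jk: "j \<in> I" "k \<in> I" "i \<noteq> j" "i \<noteq> k" "j \<noteq> k" using three[OF i] by blast
    show ?thesis
      by (rule finite_index_commutative_subgroup[OF L[OF i] L[OF jk(1)] L[OF jk(2)]
          comm[OF i jk(1,3)] comm[OF i jk(2,4)] comm[OF jk(1,2,5)] fo[OF jk(1)] fo[OF jk(2)]])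
  qed
  then have "\<exists>M. subgroup M G \<and> M \<subseteq> ?N \<and> finite_index_in G M ?N \<and> acts_commutatively M"
    by (intro finite_index_commutative_generate[OF finI L comm])
  then obtain M where M: "subgroup M G" "M \<subseteq> ?N" "finite_index_in G M ?N" "acts_commutatively M"
    by blast
  have "finite_index_in G M (carrier G)"
    by (rule finite_index_in_trans[OF M(3) co])
      (use M(1) N subgroup.subset subgroup_self in blast)+
  then show False using finite_if_finite_index_commutative[OF nst M(1,4)] inf by blast
qed

end

section \<open>Rigid stabilizers\<close>

lemma tree_verts_prefix: "w \<in> tree_verts A \<Longrightarrow> prefix v w \<Longrightarrow> v \<in> tree_verts A"
  unfolding tree_verts_def prefix_def
  by (auto simp: nth_append) (metis trans_less_add1)

lemma tree_adj_snoc: "tree_adj v (v @ [a])"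
  unfolding tree_adj_def by simp

lemma tree_adj_imp_prefix: "length v < length w \<Longrightarrow> tree_adj v w \<Longrightarrow> prefix v w"
  unfolding tree_adj_def by auto

context
  fixes A :: "nat \<Rightarrow> 'a set" and g :: "'a list \<Rightarrow> 'a list"
  assumes g: "g \<in> tree_auts A"
begin

lemma tree_aut_closed: "v \<in> tree_verts A \<Longrightarrow> g v \<in> tree_verts A"
  using g Bij_imp_funcset unfolding tree_auts_def by blast

lemma tree_aut_inj: "v \<in> tree_verts A \<Longrightarrow> w \<in> tree_verts A \<Longrightarrow> g v = g w \<Longrightarrow> v = w"
  using g unfolding tree_auts_def Bij_def bij_betw_def by (auto dest: inj_onD)

lemma tree_aut_adj:
  "v \<in> tree_verts A \<Longrightarrow> w \<in> tree_verts A \<Longrightarrow> tree_adj v w \<Longrightarrow> tree_adj (g v) (g w)"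
  using g unfolding tree_auts_def by blast

text \<open>For \<open>v = u @ [a]\<close>, adjacency makes \<open>g v\<close> a child or the parent
  of \<open>g u\<close>. In the second case \<open>g v = g p\<close> for the parent \<open>p\<close>
  of \<open>u\<close>, against injectivity. The argument goes two levels up, hence the strong
  induction.\<close>

lemma tree_aut_length: "v \<in> tree_verts A \<Longrightarrow> length (g v) = length v"
proof (induction v rule: length_induct)
  case (1 v)
  note IH = 1(1)[rule_format] and v = 1(2)
  show ?case
  proof (cases v rule: rev_cases)
    case Nil
    then show ?thesis using g unfolding tree_auts_def by simp
  next
    case (snoc u a)
    have u: "u \<in> tree_verts A" using tree_verts_prefix[OF v] snoc by simp
    have lu: "length (g u) = length u" using IH[OF _ u] snoc by simp
    have "tree_adj (g u) (g v)" using tree_aut_adj[OF u v] snoc by (simp add: tree_adj_snoc)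
    then consider "length (g v) = Suc (length (g u))"
      | "prefix (g v) (g u)" "length (g u) = Suc (length (g v))"
      unfolding tree_adj_def by blast
    then show ?thesis
    proof cases
      case 1
      then show ?thesis using lu snoc by simp
    next
      case 2
      then obtain p b where p: "u = p @ [b]" using lu by (cases u rule: rev_cases) auto
      have pV: "p \<in> tree_verts A" using tree_verts_prefix[OF u] p by simp
      have lp: "length (g p) = length p" using IH[OF _ pV] snoc p by simp
      have "tree_adj (g p) (g u)" using tree_aut_adj[OF pV u] p by (simp add: tree_adj_snoc)
      then have "prefix (g p) (g u)" by (rule tree_adj_imp_prefix[rotated]) (use lp lu p in simp)
      then have "g p = g v"
        using 2 lp lu p by (metis Suc_inject length_append_singleton prefix_same_cases
            prefix_length_prefix prefix_order.antisym order_refl)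
      then show ?thesis using tree_aut_inj[OF pV v] snoc p by simp
    qed
  qed
qed

text \<open>Adjacency and length together force the parent of a vertex to be sent to the parent of
  its image.\<close>

lemma tree_aut_prefix: "w \<in> tree_verts A \<Longrightarrow> prefix v w \<Longrightarrow> prefix (g v) (g w)"
proof (induction w rule: rev_induct)
  case Nil
  then show ?case by simp
next
  case (snoc a w)
  have w: "w \<in> tree_verts A" using tree_verts_prefix[OF snoc.prems(1)] by simp
  have "tree_adj (g w) (g (w @ [a]))" using tree_aut_adj[OF w snoc.prems(1) tree_adj_snoc] .
  then have "prefix (g w) (g (w @ [a]))"
    by (rule tree_adj_imp_prefix[rotated])
      (simp add: tree_aut_length[OF w] tree_aut_length[OF snoc.prems(1)])
  then show ?case
    using snoc.IH[OF w] snoc.prems(2) by (auto intro: prefix_order.trans)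
qed

end

lemma tree_aut_eqI:
  assumes "g \<in> tree_auts A" "h \<in> tree_auts A" "\<And>v. v \<in> tree_verts A \<Longrightarrow> g v = h v"
  shows "g = h"
  using assms unfolding tree_auts_def Bij_def by (auto intro: extensionalityI)

lemma Aut_tree_mult:
  assumes "g \<in> tree_auts A" "h \<in> tree_auts A" "v \<in> tree_verts A"
  shows "(g \<otimes>\<^bsub>Aut_tree A\<^esub> h) v = g (h v)"
  using assms unfolding Aut_tree_def BijGroup_def tree_auts_def by (simp add: compose_eq)

lemma Aut_tree_one: "v \<in> tree_verts A \<Longrightarrow> \<one>\<^bsub>Aut_tree A\<^esub> v = v"
  unfolding Aut_tree_def BijGroup_def by simp

lemma carrier_Aut_tree: "carrier (Aut_tree A) = tree_auts A"
  unfolding Aut_tree_def by simp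

interpretation Aut_tree: group "Aut_tree A" for A :: "nat \<Rightarrow> 'a set"
  by (rule group_Aut_tree)

lemma Aut_tree_inv:
  assumes g: "g \<in> tree_auts A" and v: "v \<in> tree_verts A"
  shows "(inv\<^bsub>Aut_tree A\<^esub> g) (g v) = v" "g ((inv\<^bsub>Aut_tree A\<^esub> g) v) = v"
proof -
  have i: "inv\<^bsub>Aut_tree A\<^esub> g \<in> tree_auts A"
    using Aut_tree.inv_closed[of g A] g by (simp add: carrier_Aut_tree)
  show "(inv\<^bsub>Aut_tree A\<^esub> g) (g v) = v"
    using Aut_tree_mult[OF i g v] Aut_tree.l_inv[of g A] g v
    by (simp add: carrier_Aut_tree Aut_tree_one)
  show "g ((inv\<^bsub>Aut_tree A\<^esub> g) v) = v"
    using Aut_tree_mult[OF g i v] Aut_tree.r_inv[of g A] g v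
    by (simp add: carrier_Aut_tree Aut_tree_one)
qed

section \<open>Rigid stabilizers: supports, commutation and conjugation\<close>

context
  fixes A :: "nat \<Rightarrow> 'a set" and G :: "('a list \<Rightarrow> 'a list) set"
  assumes G: "subgroup G (Aut_tree A)"
begin

lemma tree_group_auts: "g \<in> G \<Longrightarrow> g \<in> tree_auts A"
  using subgroup.mem_carrier[OF G] by (simp add: carrier_Aut_tree)

lemma Rist_fix: "g \<in> Rist A G v \<Longrightarrow> w \<in> tree_verts A \<Longrightarrow> \<not> prefix v w \<Longrightarrow> g w = w"
  unfolding Rist_def subtree_def by blast

lemma RistI:
  "g \<in> G \<Longrightarrow> (\<And>w. w \<in> tree_verts A \<Longrightarrow> \<not> prefix v w \<Longrightarrow> g w = w) \<Longrightarrow> g \<in> Rist A G v"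
  unfolding Rist_def subtree_def by blast

lemma Rist_subset: "Rist A G v \<subseteq> G"
  unfolding Rist_def by blast

text \<open>If \<open>g w\<close> lay outside the subtree, it would be fixed by \<open>g\<close>,
  and injectivity would give \<open>g w = w\<close>.\<close>

lemma Rist_preserves_subtree:
  assumes g: "g \<in> Rist A G v" and w: "w \<in> tree_verts A" "prefix v w"
  shows "prefix v (g w)"
proof (rule ccontr)
  assume n: "\<not> prefix v (g w)"
  have ga: "g \<in> tree_auts A" using g Rist_subset tree_group_auts by blast
  have gw: "g w \<in> tree_verts A" by (rule tree_aut_closed[OF ga w(1)])
  have "g w = w" using tree_aut_inj[OF ga gw w(1) Rist_fix[OF g gw n]] .
  then show False using n w by simp
qed

lemma subgroup_Rist: "subgroup (Rist A G v) (Aut_tree A)"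
proof (rule Aut_tree.subgroupI)
  show "Rist A G v \<subseteq> carrier (Aut_tree A)"
    using Rist_subset subgroup.subset[OF G] by blast
  have "\<one>\<^bsub>Aut_tree A\<^esub> \<in> Rist A G v"
    by (rule RistI) (simp_all add: subgroup.one_closed[OF G] Aut_tree_one)
  then show "Rist A G v \<noteq> {}" by blast
next
  fix g assume g: "g \<in> Rist A G v"
  then have gG: "g \<in> G" using Rist_subset by blast
  have ga: "g \<in> tree_auts A" using gG tree_group_auts by blast
  show "inv\<^bsub>Aut_tree A\<^esub> g \<in> Rist A G v"
  proof (rule RistI)
    show "inv\<^bsub>Aut_tree A\<^esub> g \<in> G" by (rule subgroup.m_inv_closed[OF G gG])
    show "(inv\<^bsub>Aut_tree A\<^esub> g) w = w" if "w \<in> tree_verts A" "\<not> prefix v w" for w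
      using Aut_tree_inv(1)[OF ga that(1)] Rist_fix[OF g that] by simp
  qed
  fix h assume h: "h \<in> Rist A G v"
  then have hG: "h \<in> G" using Rist_subset by blast
  have ha: "h \<in> tree_auts A" using hG tree_group_auts by blast
  show "g \<otimes>\<^bsub>Aut_tree A\<^esub> h \<in> Rist A G v"
  proof (rule RistI)
    show "g \<otimes>\<^bsub>Aut_tree A\<^esub> h \<in> G" by (rule subgroup.m_closed[OF G gG hG])
    show "(g \<otimes>\<^bsub>Aut_tree A\<^esub> h) w = w" if "w \<in> tree_verts A" "\<not> prefix v w" for w
      using Aut_tree_mult[OF ga ha that(1)] Rist_fix[OF h that] Rist_fix[OF g that] by simp
  qed
qed

text \<open>Distinct vertices of equal length have disjoint subtrees, and automorphisms supported on
  disjoint invariant sets commute.\<close>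

lemma Rist_commute:
  assumes g: "g \<in> Rist A G v" and h: "h \<in> Rist A G w" and vw: "length v = length w" "v \<noteq> w"
  shows "g \<otimes>\<^bsub>Aut_tree A\<^esub> h = h \<otimes>\<^bsub>Aut_tree A\<^esub> g"
proof -
  have a: "g \<in> tree_auts A" "h \<in> tree_auts A" using g h Rist_subset tree_group_auts by blast+
  have disj: "\<not> prefix w u" if "prefix v u" for u
    using vw that by (metis prefix_length_prefix prefix_order.antisym order_refl)
  have "g (h u) = h (g u)" if u: "u \<in> tree_verts A" for u
  proof (cases "prefix v u")
    case True
    then have "h u = u" "h (g u) = g u"
      using disj u Rist_fix[OF h] Rist_preserves_subtree[OF g u True] tree_aut_closed[OF a(1) u]
      by blast+
    then show ?thesis by simp
  next
    case v: False
    then have gu: "g u = u" using Rist_fix[OF g u] by blast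
    have "g (h u) = h u"
    proof (cases "prefix w u")
      case True
      then have "prefix w (h u)" by (rule Rist_preserves_subtree[OF h u])
      then show ?thesis using disj Rist_fix[OF g tree_aut_closed[OF a(2) u]] by blast
    next
      case False
      then show ?thesis using Rist_fix[OF h u] gu by simp
    qed
    then show ?thesis using gu by simp
  qed
  moreover have "g \<otimes>\<^bsub>Aut_tree A\<^esub> h \<in> tree_auts A" "h \<otimes>\<^bsub>Aut_tree A\<^esub> g \<in> tree_auts A"
    using Aut_tree.m_closed a by (metis carrier_Aut_tree)+
  ultimately show ?thesis
    by (intro tree_aut_eqI) (auto simp: Aut_tree_mult a)
qed

text \<open>The support of a conjugate is the translated support: if \<open>w\<close> is not below
  \<open>g v\<close>, then \<open>g^-1 w\<close> is not below \<open>v\<close>, because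
  \<open>g\<close> preserves prefixes.\<close>

lemma Rist_conj:
  assumes g: "g \<in> G" and l: "l \<in> Rist A G v"
  shows "g \<otimes>\<^bsub>Aut_tree A\<^esub> l \<otimes>\<^bsub>Aut_tree A\<^esub> inv\<^bsub>Aut_tree A\<^esub> g \<in> Rist A G (g v)"
proof (rule RistI)
  let ?i = "inv\<^bsub>Aut_tree A\<^esub> g"
  have lG: "l \<in> G" using l Rist_subset by blast
  have iG: "?i \<in> G" by (rule subgroup.m_inv_closed[OF G g])
  have glG: "g \<otimes>\<^bsub>Aut_tree A\<^esub> l \<in> G" by (rule subgroup.m_closed[OF G g lG])
  show "g \<otimes>\<^bsub>Aut_tree A\<^esub> l \<otimes>\<^bsub>Aut_tree A\<^esub> ?i \<in> G"
    by (rule subgroup.m_closed[OF G glG iG])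
  fix w assume w: "w \<in> tree_verts A" "\<not> prefix (g v) w"
  note ga = tree_group_auts[OF g] and ia = tree_group_auts[OF iG]
  have iw: "?i w \<in> tree_verts A" by (rule tree_aut_closed[OF ia w(1)])
  have giw: "g (?i w) = w" by (rule Aut_tree_inv(2)[OF ga w(1)])
  have "\<not> prefix v (?i w)" using tree_aut_prefix[OF ga iw] w(2) giw by metis
  then have "l (?i w) = ?i w" by (rule Rist_fix[OF l iw])
  then show "(g \<otimes>\<^bsub>Aut_tree A\<^esub> l \<otimes>\<^bsub>Aut_tree A\<^esub> ?i) w = w"
    using Aut_tree_mult[OF tree_group_auts[OF glG] ia w(1)]
      Aut_tree_mult[OF ga tree_group_auts[OF lG] iw] giw by simp
qed

end

section \<open>Branch groups and their transitivity degree\<close>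

lemma finite_tree_level:
  assumes "\<And>i. finite (A i)"
  shows "finite (tree_level A n)"
proof -
  have "tree_level A n \<subseteq> {xs. set xs \<subseteq> (\<Union>i<n. A i) \<and> length xs = n}"
    unfolding tree_level_def tree_verts_def by (fastforce simp: in_set_conv_nth)
  then show ?thesis using assms finite_lists_length_eq[of "\<Union>i<n. A i" n] finite_subset by fastforce
qed

lemma card_ge_2_obtain:
  assumes "card S \<ge> 2"
  obtains a b where "a \<in> S" "b \<in> S" "a \<noteq> b"
  using assms by (metis card_2_iff insert_subset obtain_subset_with_card_n)

lemma branch_group_no_2_set_transitive_action:
  fixes A :: "nat \<Rightarrow> 'a set"
  assumes fin: "\<And>i. finite (A i)" and two: "\<And>i. card (A i) \<ge> 2" and br: "branch_group A G"
    and act: "group_action (tree_group A G) E \<phi>"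
    and nst: "n_set_transitive (tree_group A G) E \<phi> 2"
  shows "finite E"
proof (rule ccontr)
  assume inf: "infinite E"
  let ?T = "tree_group A G" and ?I = "tree_level A 2"
  interpret group_action ?T E \<phi> by (rule act)
  interpret T: group ?T using group_hom group_hom.axioms(1) by blast
  have G: "subgroup G (Aut_tree A)" using br unfolding branch_group_def by blast
  have inv: "inv\<^bsub>?T\<^esub> g = inv\<^bsub>Aut_tree A\<^esub> g" if "g \<in> G" for g
    by (rule Aut_tree.m_inv_consistent[OF G that])
  show False
  \<comment> \<open>Level 2 is used because three pairwise commuting subgroups are required, while
    level 1 may have only two vertices.\<close>
  proof (rule no_2_set_transitive_action[where I = ?I and L = "Rist A G", OF nst inf])
    show "finite ?I" by (rule finite_tree_level[OF fin])
    obtain a a' where a: "a \<in> A 0" "a' \<in> A 0" "a \<noteq> a'" by (rule card_ge_2_obtain[OF two])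
    obtain b b' where b: "b \<in> A 1" "b' \<in> A 1" "b \<noteq> b'" by (rule card_ge_2_obtain[OF two])
    have "[a, b] \<in> ?I" "[a, b'] \<in> ?I" "[a', b] \<in> ?I"
      using a b unfolding tree_level_def tree_verts_def by (auto simp: less_Suc_eq numeral_2_eq_2)
    then show "\<exists>j\<in>?I. \<exists>k\<in>?I. i \<noteq> j \<and> i \<noteq> k \<and> j \<noteq> k" if "i \<in> ?I" for i
      using a(3) b(3) by (metis list.inject)
    show "subgroup (Rist A G v) ?T" for v
      by (rule Aut_tree.subgroup_incl[OF subgroup_Rist[OF G] G Rist_subset[OF G]])
    show "x \<otimes>\<^bsub>?T\<^esub> y = y \<otimes>\<^bsub>?T\<^esub> x"
      if "v \<in> ?I" "w \<in> ?I" "v \<noteq> w" "x \<in> Rist A G v" "y \<in> Rist A G w" for v w x y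
      using Rist_commute[OF G that(4,5)] that(1-3) unfolding tree_level_def by simp
    have conj: "g \<otimes>\<^bsub>?T\<^esub> l \<otimes>\<^bsub>?T\<^esub> inv\<^bsub>?T\<^esub> g \<in> Rist A G (g v)"
      if "g \<in> carrier ?T" "l \<in> Rist A G v" for g l v
      using Rist_conj[OF G, of g l v] that inv by simp
    show "\<exists>w\<in>?I. \<forall>l\<in>Rist A G v. g \<otimes>\<^bsub>?T\<^esub> l \<otimes>\<^bsub>?T\<^esub> inv\<^bsub>?T\<^esub> g \<in> Rist A G w"
      if "g \<in> carrier ?T" "v \<in> ?I" for g v
    proof
      have "g \<in> tree_auts A" using tree_group_auts[OF G] that(1) by simp
      then show "g v \<in> ?I"
        using that(2) unfolding tree_level_def by (auto simp: tree_aut_closed tree_aut_length)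
    qed (use conj that in blast)
    show "\<exists>g\<in>carrier ?T. \<forall>l\<in>Rist A G v. g \<otimes>\<^bsub>?T\<^esub> l \<otimes>\<^bsub>?T\<^esub> inv\<^bsub>?T\<^esub> g \<in> Rist A G w"
      if "v \<in> ?I" "w \<in> ?I" for v w
    proof -
      have "\<exists>g\<in>G. g v = w" using br that unfolding branch_group_def by blast
      then show ?thesis using conj by fastforce
    qed
    let ?U = "\<Union>v\<in>?I. Rist A G v"
    have U: "?U \<subseteq> G" using Rist_subset[OF G] by blast
    \<comment> \<open>\<open>Rist_level\<close> is generated inside the full automorphism group; as
      the generators lie in \<open>G\<close>, generating inside \<open>G\<close> yields the same
      subgroup.\<close>
    then have gen: "generate ?T ?U = Rist_level A G 2"
      unfolding Rist_level_def using Aut_tree.generate_consistent[OF U G] by simp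
    have "subgroup (generate ?T ?U) ?T" by (rule T.generate_is_subgroup) (use U in simp)
    then show "finite_index_in ?T (generate ?T ?U) (carrier ?T)"
      by (rule T.finite_index_in_if_finite_rcosets) (use br gen in \<open>simp add: branch_group_def\<close>)
  qed
qed

text \<open>By level transitivity, the orbit of a vertex is its whole level, and level
  \<open>n\<close> has at least \<open>n\<close> vertices. The choice of \<open>n\<close> as one
  more than \<open>card G\<close> contradicts finiteness.\<close>

lemma infinite_branch_group:
  fixes A :: "nat \<Rightarrow> 'a set"
  assumes two: "\<And>i. card (A i) \<ge> 2" and br: "branch_group A G"
  shows "infinite G"
proof
  assume finG: "finite G"
  define n where "n = Suc (card G)"
  have "\<exists>a b. a \<in> A i \<and> b \<in> A i \<and> a \<noteq> b" for i by (rule card_ge_2_obtain[OF two]) blast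
  then obtain a b where ab: "\<And>i. a i \<in> A i" "\<And>i. b i \<in> A i" "\<And>i. a i \<noteq> b i" by metis
  \<comment> \<open>The word \<open>w k\<close> deviates from the word spelled by \<open>a\<close>
    exactly at position \<open>k\<close>, which makes these \<open>n\<close> words distinct.\<close>
  define w where "w k = map (\<lambda>i. if i = k then b i else a i) [0..<n]" for k
  have w: "w k \<in> tree_level A n" for k
    unfolding tree_level_def tree_verts_def w_def using ab by auto
  have "inj_on w {..<n}"
  proof (rule inj_onI)
    fix k l assume kl: "k \<in> {..<n}" "l \<in> {..<n}" "w k = w l"
    have "w k ! k = w l ! k" using kl(3) by simp
    then show "k = l" using kl(1) ab(3)[of k] unfolding w_def by (auto split: if_splits)
  qed
  then have "n = card (w ` {..<n})" by (simp add: card_image)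
  also have "\<dots> \<le> card ((\<lambda>g. g (w 0)) ` G)"
  proof (rule card_mono)
    have "\<exists>g\<in>G. g (w 0) = w k" for k using br w unfolding branch_group_def by blast
    then have "w k \<in> (\<lambda>g. g (w 0)) ` G" for k by (metis image_eqI)
    then show "w ` {..<n} \<subseteq> (\<lambda>g. g (w 0)) ` G" by (rule image_subsetI)
  qed (use finG in simp)
  also have "\<dots> \<le> card G" using finG by (rule card_image_le)
  finally show False unfolding n_def by simp
qed

text \<open>A finite set has only finitely many permutations. This excludes small sets from the
  transitivity degree, on which \<open>n_transitive\<close> would hold vacuously.\<close>

lemma infinite_if_faithful_action:
  assumes act: "faithful_action G E \<phi>" and inf: "infinite (carrier G)"
  shows "infinite E"
proof
  assume finE: "finite E"
  interpret faithful_action G E \<phi> by (rule act)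
  have "\<phi> ` carrier G \<subseteq> E \<rightarrow>\<^sub>E E"
    using bij_prop0 unfolding Bij_def by (auto simp: PiE_def bij_betw_def)
  then have "finite (\<phi> ` carrier G)" using finE by (meson finite_PiE finite_subset)
  then show False using inf faithful finite_imageD by blast
qed

text \<open>In an infinite set any two distinct points extend to a tuple of \<open>n\<close>
  distinct points, so higher transitivity restricts to the first two entries.\<close>

lemma n_set_transitive_2_if_n_transitive:
  assumes nt: "n_transitive G E \<phi> n" and n: "n \<ge> 2" and inf: "infinite E"
  shows "n_set_transitive G E \<phi> 2"
  unfolding n_set_transitive_def
proof (intro allI impI)
  have extend: "\<exists>zs. set (x # y # zs) \<subseteq> E \<and> distinct (x # y # zs) \<and> length (x # y # zs) = n"
    if "x \<in> E" "y \<in> E" "x \<noteq> y" for x y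
  proof -
    obtain Z where Z: "Z \<subseteq> E - {x, y}" "finite Z" "card Z = n - 2"
      using infinite_arbitrarily_large[of "E - {x, y}"] inf by auto
    then obtain zs where zs: "set zs = Z" "distinct zs" using finite_distinct_list by blast
    then have "length zs = n - 2" using Z(3) distinct_card by metis
    then show ?thesis using zs Z(1) n that by (intro exI[of _ zs]) auto
  qed
  fix B C assume BC: "B \<subseteq> E \<and> finite B \<and> card B = 2 \<and> C \<subseteq> E \<and> finite C \<and> card C = 2"
  then obtain x y u v where xy: "B = {x, y}" "x \<noteq> y" "C = {u, v}" "u \<noteq> v"
    by (metis card_2_iff)
  obtain zs where zs: "set (x # y # zs) \<subseteq> E" "distinct (x # y # zs)" "length (x # y # zs) = n"
    using extend[of x y] BC xy by blast
  obtain ws where ws: "set (u # v # ws) \<subseteq> E" "distinct (u # v # ws)" "length (u # v # ws) = n"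
    using extend[of u v] BC xy by blast
  have "\<exists>g\<in>carrier G. map (\<phi> g) (x # y # zs) = u # v # ws"
    using zs ws by (intro nt[unfolded n_transitive_def, rule_format] conjI)
  then obtain g where "g \<in> carrier G" "map (\<phi> g) (x # y # zs) = u # v # ws"
    by (rule bexE)
  then show "\<exists>g\<in>carrier G. \<phi> g ` B = C" unfolding xy by (intro bexI[of _ g]) auto
qed

text \<open>The regular action is faithful as well, so it bounds the transitivity degree from below
  by 1.\<close>

lemma (in group) n_transitive_1_regular:
  "n_transitive G (carrier G) (\<lambda>g. \<lambda>x\<in>carrier G. g \<otimes> x) 1"
  unfolding n_transitive_def
proof (intro allI impI)
  fix xs ys
  assume a: "set xs \<subseteq> carrier G \<and> distinct xs \<and> length xs = 1 \<and>
             set ys \<subseteq> carrier G \<and> distinct ys \<and> length ys = 1"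
  then obtain x y where xy: "xs = [x]" "ys = [y]" by (metis One_nat_def length_0_conv length_Suc_conv)
  have "y \<otimes> inv x \<in> carrier G" "y \<otimes> inv x \<otimes> x = y" using a xy by (auto simp: m_assoc)
  then show "\<exists>g\<in>carrier G. map (\<lambda>x\<in>carrier G. g \<otimes> x) xs = ys"
    using a xy by (intro bexI[of _ "y \<otimes> inv x"]) auto
qed

theorem corollary1p2:
  fixes A :: "nat \<Rightarrow> 'a set" and G :: "('a list \<Rightarrow> 'a list) set"
  assumes "\<And>i. finite (A i)" and "\<And>i. card (A i) \<ge> 2"
    and "branch_group A G"
  shows "(\<nexists>(\<Omega> :: 'x set) \<phi>. infinite \<Omega> \<and> group_action (tree_group A G) \<Omega> \<phi> \<and>
             n_set_transitive (tree_group A G) \<Omega> \<phi> 2) \<and>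
         (\<nexists>(\<Omega> :: 'x set) \<phi>. infinite \<Omega> \<and> group_action (tree_group A G) \<Omega> \<phi> \<and>
             n_transitive (tree_group A G) \<Omega> \<phi> 2) \<and>
         transitivity_degree (tree_group A G) = 1"
proof (intro conjI)
  let ?T = "tree_group A G"
  \<comment> \<open>This fact is polymorphic in the points acted on: it serves both the sets of the
    first two claims and the sets of group elements over which \<open>transitivity_degree\<close>
    ranges.\<close>
  note no_action = branch_group_no_2_set_transitive_action[OF assms]
  show "\<nexists>(\<Omega> :: 'x set) \<phi>. infinite \<Omega> \<and> group_action ?T \<Omega> \<phi> \<and> n_set_transitive ?T \<Omega> \<phi> 2"
    using no_action by blast
  show "\<nexists>(\<Omega> :: 'x set) \<phi>. infinite \<Omega> \<and> group_action ?T \<Omega> \<phi> \<and> n_transitive ?T \<Omega> \<phi> 2"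
    using no_action n_set_transitive_2_if_n_transitive by blast
  have G: "subgroup G (Aut_tree A)" using assms(3) unfolding branch_group_def by blast
  interpret T: group ?T by (rule Aut_tree.subgroup_imp_group[OF G])
  have inf: "infinite (carrier ?T)" using infinite_branch_group[OF assms(2,3)] by simp
  show "transitivity_degree ?T = 1"
    unfolding transitivity_degree_def
  proof (rule antisym)
    have "n \<le> 1" if act: "faithful_action ?T \<Omega> \<phi>" and nt: "n_transitive ?T \<Omega> \<phi> n"
      for n and \<Omega> :: "('a list \<Rightarrow> 'a list) set" and \<phi>
    proof (rule ccontr)
      assume "\<not> n \<le> 1"
      then have "n \<ge> 2" by simp
      have \<Omega>: "infinite \<Omega>" by (rule infinite_if_faithful_action[OF act inf])
      have "group_action ?T \<Omega> \<phi>" using act by (rule faithful_action.axioms(1))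
      then show False
        using no_action n_set_transitive_2_if_n_transitive[OF nt \<open>n \<ge> 2\<close> \<Omega>] \<Omega> by blast
    qed
    then show "Sup {enat n |n. \<exists>(\<Omega> :: ('a list \<Rightarrow> 'a list) set) \<phi>.
        faithful_action ?T \<Omega> \<phi> \<and> n_transitive ?T \<Omega> \<phi> n} \<le> 1"
      by (intro Sup_least) (auto simp: one_enat_def)
    have "\<exists>(\<Omega> :: ('a list \<Rightarrow> 'a list) set) \<phi>. faithful_action ?T \<Omega> \<phi> \<and> n_transitive ?T \<Omega> \<phi> 1"
      using T.faithful_action_regular T.n_transitive_1_regular by blast
    then show "1 \<le> Sup {enat n |n. \<exists>(\<Omega> :: ('a list \<Rightarrow> 'a list) set) \<phi>.
        faithful_action ?T \<Omega> \<phi> \<and> n_transitive ?T \<Omega> \<phi> n}"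
      by (intro Sup_upper) (auto simp only: one_enat_def)
  qed
qed

end
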